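(* Let $\mathfrak L$ be an untwisted affine Lie superalgebra with root system $R$, and let $M$ be an $\mathfrak L$-module having shadow. Write $R^{in}=R^{in}_M$ and $R^{ln}=R^{ln}_M$. Then for each $\beta\in R_{re}$ one of the following happens: (i) $\beta+\mathbb Z\delta\subseteq R^{ln}$. (ii) $\beta+\mathbb Z\delta\subseteq R^{in}$. (iii) There exist $m\in\mathbb Z$ and $t\in\{-1,0,1\}$ such that, for $\gamma:=\beta+m\delta$, $$\gamma+\mathbb Z^{\ge 1}\delta\subseteq R^{in},\quad \gamma+\mathbb Z^{\le 0}\delta\subseteq R^{ln},\quad -\gamma+\mathbb Z^{\ge t}\delta\subseteq R^{in},\quad -\gamma+\mathbb Z^{\le t-1}\delta\subseteq R^{ln}.$$ (iv) There exist $m\in\mathbb Z$ and $t\in\{-1,0,1\}$ such that, for $\eta:=\beta+m\delta$, $$\eta+\mathbb Z^{\le -1}\delta\subseteq R^{in},\quad \eta+\mathbb Z^{\ge 0}\delta\subseteq R^{ln},\quad -\eta+\mathbb Z^{\le -t}\delta\subseteq R^{in},\quad -\eta+\mathbb Z^{\ge 1-t}\delta\subseteq R^{ln}.$$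
   Context: **Untwisted affine Lie superalgebras.** The ground field is $\mathbb C$. Let $\mathfrak g=\mathfrak g_0\oplus\mathfrak g_1$ be a finite dimensional basic classical simple Lie superalgebra with $\mathfrak g_1\neq0$, i.e. of type $A(m,n)$ ($\mathfrak{sl}(m+1,n+1)$, $m>n\ge0$), $A(n,n)$ ($\mathfrak{psl}(n+1,n+1)$, $n\ge1$), $B(m,n)$ ($\mathfrak{osp}(2m+1,2n)$, $m\ge0,n>0$), $C(n)$ ($\mathfrak{osp}(2,2n-2)$, $n\ge2$), $D(m,n)$ ($\mathfrak{osp}(2m,2n)$, $m\ge2,n\ge1$), $D(2,1;\lambda)$ ($\lambda\ne0,-1$), $G(3)$ or $F(4)$. Let $\mathfrak h_0\subseteq\mathfrak g_0$ be the standard Cartan subalgebra, $\dot R\subseteq\mathfrak h_0^*$ the root system of $\mathfrak g$ (with $0\in\dot R$), and $\kappa$ a nondegenerate even supersymmetric invariant bilinear form on $\mathfrak g$. If $\mathfrak g$ is not of type $A(n,n)$: $\mathfrak L=\mathfrak g\otimes\mathbb C[t^{\pm1}]\oplus\mathbb Cc\oplus\mathbb Cd$, $c$ central, $[d,x\otimes t^p]=p\,x\otimes t^p$, $[x\otimes t^p,y\otimes t^q]=[x,y]\otimes t^{p+q}+p\,\kappa(x,y)\delta_{p+q,0}c$; $\mathfrak H=(\mathfrak h_0\otimes1)\oplus\mathbb Cc\oplus\mathbb Cd$. Elements of $\dot R$ are extended to $\mathfrak H$ by $0$ on $c,d$; $\delta\in\mathfrak H^*$ is $0$ on $\mathfrak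 h_0\otimes 1$ and $c$, and $\delta(d)=1$. The root system is $R=\dot R+\mathbb Z\delta$. If $\mathfrak g=\mathfrak{psl}(n+1,n+1)$: let $\delta^*:\mathfrak g\to\mathfrak g$ be $+1$ on the strictly upper block part of $\mathfrak g_1$, $-1$ on the strictly lower block part of $\mathfrak g_1$, $0$ on $\mathfrak g_0$. Then $\mathfrak L=\mathfrak g\otimes\mathbb C[t^{\pm1}]\oplus\mathbb Cc_1\oplus\mathbb Cc_2\oplus\mathbb Cd_1\oplus\mathbb Cd_2$ with $c_1,c_2$ central, $[d_1,d_2]=0$, $[d_1,X\otimes t^m]=2\delta^*(X)\otimes t^m$, $[d_2,X\otimes t^m]=mX\otimes t^m$, $[X\otimes t^m,Y\otimes t^u]=[X,Y]\otimes t^{m+u}+\delta_{m+u,0}\big(\tfrac1{n+1}\kappa(\delta^*(X),Y)c_1+m\,\kappa(X,Y)c_2\big)$; $\mathfrak H=(\mathfrak h_0\otimes1)\oplus\mathbb Cc_1\oplus\mathbb Cc_2\oplus\mathbb Cd_1\oplus\mathbb Cd_2$. With $\dot\epsilon_i$, $\dot\delta_j$ ($1\le i,j\le n+1$) the usual diagonal functionals restricted to $\mathfrak h_0$ (extended by $0$ to $c_i,d_i$), and $\sigma,\delta\in\mathfrak H^*$ vanishing on $\mathfrak h_0\otimes 1,c_1,c_2$ with $\sigma(d_1)=2,\sigma(d_2)=0,\delta(d_1)=0,\delta(d_2)=1$, the root system is $R=\{\dot\epsilon_i-\dot\epsilon_j,\dot\delta_i-\dot\delta_j,\pm(\dot\epsilon_i-\dot\delta_j+\sigma)\}+\mathbb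 Z\delta$. In all cases $0\in R$, $\mathfrak L=\bigoplus_{\alpha\in R}\mathfrak L^\alpha$ is the root space decomposition with respect to $\mathfrak H=\mathfrak L^0$. The form $\kappa$ on $\mathfrak h_0$, together with $(c,d)=1$ (resp. $(c_i,d_j)=\delta_{i,j}$) and all other pairings among these and with $\mathfrak h_0$ zero, gives a nondegenerate symmetric form on $\mathfrak H$ and hence a form $(-,-)$ on $\mathfrak H^*$. Real roots: $R_{re}=\{\alpha\in R:(\alpha,\alpha)\ne0\}$; imaginary roots: $R_{im}=\{\alpha\in R:(\alpha,R)=\{0\}\}=\mathbb Z\delta$. **Modules.** An $\mathfrak L$-module $M$ is a weight module if $M=\bigoplus_{\lambda\in\mathfrak H^*}M^\lambda$, $M^\lambda=\{v: hv=\lambda(h)v\ \forall h\in\mathfrak H\}$; $\mathrm{supp}(M)=\{\lambda:M^\lambda\ne0\}$. $R^{in}_M$ (resp. $R^{ln}_M$) is the set of all $\alpha\in R_{re}$ whose nonzero root vectors (nonzero elements of $\mathfrak L^\alpha$) act injectively (resp. locally nilpotently) on $M$. Put $\mathfrak B_M=\{\alpha\in\mathrm{span}_{\mathbb Z}R:\ \{k\in\mathbb Z^{>0}:\lambda+k\alpha\in\mathrm{supp}(M)\}\text{ is finite for all }\lambda\in\mathrm{supp}(M)\}$ and $\mathfrak C_M=\{\alpha\in\mathrm{span}_{\mathbb Z}R:\ \alpha+\mathrm{supp}(M)\subseteq\mathrm{supp}(M)\}$. A weight module $M$ has shadow if $R_{re}=R^{in}_M\cup R^{ln}_M$, $R^{ln}_M=\mathfrak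 B_M\cap R_{re}$ and $R^{in}_M=\mathfrak C_M\cap R_{re}$. *)

theory Defs
  imports
    Complex_Main
    "HOL-Library.Z2"
    "HOL-Library.Function_Algebras"
    "HOL-Library.Product_Plus"
    "HOL-Library.Poly_Mapping"
    "HOL-Computational_Algebra.Group_Closure"
    "Jordan_Normal_Form.Matrix"
begin

section \<open>Lie superalgebras over the complex numbers\<close>

text \<open>
  The underlying vector space of a Lie superalgebra is a whole type, with scalar multiplication
  \<open>smul\<close>. Its homogeneous parts are indexed by the field \<open>bit\<close> with two elements.
\<close>

record 'g lie_data =
  smul :: "complex \<Rightarrow> 'g \<Rightarrow> 'g"
  brack :: "'g \<Rightarrow> 'g \<Rightarrow> 'g"
  hpart :: "bit \<Rightarrow> 'g set"

abbreviation lspan :: "(complex \<Rightarrow> 'a \<Rightarrow> 'a) \<Rightarrow> 'a set \<Rightarrow> 'a::ab_group_add set" where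
  "lspan \<equiv> Modules.module.span"

abbreviation lsubspace :: "(complex \<Rightarrow> 'a \<Rightarrow> 'a) \<Rightarrow> 'a::ab_group_add set \<Rightarrow> bool" where
  "lsubspace \<equiv> Modules.module.subspace"

definition koszul :: "bit \<Rightarrow> bit \<Rightarrow> complex" where
  "koszul p q = (if p = 1 \<and> q = 1 then - 1 else 1)"

definition bilinear_map ::
  "(complex \<Rightarrow> 'a \<Rightarrow> 'a) \<Rightarrow> (complex \<Rightarrow> 'b \<Rightarrow> 'b) \<Rightarrow> (complex \<Rightarrow> 'c \<Rightarrow> 'c)
    \<Rightarrow> ('a::ab_group_add \<Rightarrow> 'b::ab_group_add \<Rightarrow> 'c::ab_group_add) \<Rightarrow> bool" where
  "bilinear_map s1 s2 s3 f \<longleftrightarrow>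
     (\<forall>y. Vector_Spaces.linear s1 s3 (\<lambda>x. f x y)) \<and> (\<forall>x. Vector_Spaces.linear s2 s3 (f x))"

definition superspace :: "(complex \<Rightarrow> 'a \<Rightarrow> 'a) \<Rightarrow> (bit \<Rightarrow> 'a::ab_group_add set) \<Rightarrow> bool" where
  "superspace s P \<longleftrightarrow>
     Vector_Spaces.vector_space s \<and> (\<forall>p. lsubspace s (P p)) \<and>
     (\<forall>x. \<exists>y\<in>P 0. \<exists>z\<in>P 1. x = y + z) \<and> P 0 \<inter> P 1 = {0}"

definition lie_superalgebra :: "('g::ab_group_add, 'z) lie_data_scheme \<Rightarrow> bool" where
  "lie_superalgebra G \<longleftrightarrow>
     superspace (smul G) (hpart G) \<and>
     bilinear_map (smul G) (smul G) (smul G) (brack G) \<and>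
     (\<forall>p q. \<forall>x\<in>hpart G p. \<forall>y\<in>hpart G q. brack G x y \<in> hpart G (p + q)) \<and>
     (\<forall>p q. \<forall>x\<in>hpart G p. \<forall>y\<in>hpart G q.
        brack G x y = - smul G (koszul p q) (brack G y x)) \<and>
     (\<forall>p q. \<forall>x\<in>hpart G p. \<forall>y\<in>hpart G q. \<forall>z.
        brack G x (brack G y z) =
          brack G (brack G x y) z + smul G (koszul p q) (brack G y (brack G x z)))"

definition invariant_form ::
  "('g::ab_group_add, 'z) lie_data_scheme \<Rightarrow> ('g \<Rightarrow> 'g \<Rightarrow> complex) \<Rightarrow> bool" where
  "invariant_form G \<kappa> \<longleftrightarrow>
     bilinear_map (smul G) (smul G) (*) \<kappa> \<and>
     (\<forall>p q. p \<noteq> q \<longrightarrow> (\<forall>x\<in>hpart G p. \<forall>y\<in>hpart G q. \<kappa> x y = 0)) \<and>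
     (\<forall>p q. \<forall>x\<in>hpart G p. \<forall>y\<in>hpart G q. \<kappa> x y = koszul p q * \<kappa> y x) \<and>
     (\<forall>x y z. \<kappa> (brack G x y) z = \<kappa> x (brack G y z))"

definition nondegenerate_form :: "('g::zero \<Rightarrow> 'g \<Rightarrow> complex) \<Rightarrow> bool" where
  "nondegenerate_form \<kappa> \<longleftrightarrow> (\<forall>x. (\<forall>y. \<kappa> x y = 0) \<longrightarrow> x = 0)"

definition graded_ideal :: "('g::ab_group_add, 'z) lie_data_scheme \<Rightarrow> 'g set \<Rightarrow> bool" where
  "graded_ideal G I \<longleftrightarrow>
     lsubspace (smul G) I \<and> (\<forall>x. \<forall>y\<in>I. brack G x y \<in> I) \<and>
     (\<forall>x\<in>I. \<exists>y\<in>I \<inter> hpart G 0. \<exists>z\<in>I \<inter> hpart G 1. x = y + z)"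

definition simple_superalgebra :: "('g::ab_group_add, 'z) lie_data_scheme \<Rightarrow> bool" where
  "simple_superalgebra G \<longleftrightarrow>
     lie_superalgebra G \<and> (\<exists>x y. brack G x y \<noteq> 0) \<and> (\<forall>I. graded_ideal G I \<longrightarrow> I = {0} \<or> I = UNIV)"

definition even_submodule :: "('g::ab_group_add, 'z) lie_data_scheme \<Rightarrow> 'g set \<Rightarrow> bool" where
  "even_submodule G V \<longleftrightarrow>
     lsubspace (smul G) V \<and> V \<subseteq> hpart G 1 \<and> (\<forall>x\<in>hpart G 0. \<forall>v\<in>V. brack G x v \<in> V)"

text \<open>
  Kac's definition of a basic classical Lie superalgebra: finite dimensional, simple, with a
  completely reducible action of the even part on the odd part, and carrying a nondegenerate even
  supersymmetric invariant form \<open>\<kappa>\<close>. Here the odd part is moreover required to be nonzero. By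
  Kac's classification these are exactly the algebras of types A, B, C, D,
  \<open>D(2,1;\<lambda>)\<close>, \<open>G(3)\<close> and \<open>F(4)\<close>.
\<close>

definition basic_classical ::
  "('g::ab_group_add, 'z) lie_data_scheme \<Rightarrow> ('g \<Rightarrow> 'g \<Rightarrow> complex) \<Rightarrow> bool" where
  "basic_classical G \<kappa> \<longleftrightarrow>
     simple_superalgebra G \<and>
     (\<exists>B. finite B \<and> lspan (smul G) B = UNIV) \<and>
     hpart G 1 \<noteq> {0} \<and>
     (\<forall>V. even_submodule G V \<longrightarrow>
        (\<exists>W. even_submodule G W \<and> V \<inter> W = {0} \<and> (\<forall>x\<in>hpart G 1. \<exists>v\<in>V. \<exists>w\<in>W. x = v + w))) \<and>
     invariant_form G \<kappa> \<and> nondegenerate_form \<kappa>"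

section \<open>Weights and Cartan subalgebras\<close>

text \<open>
  The dual of a subspace \<open>H\<close>: linear functionals on \<open>H\<close>, represented uniquely by functions on the
  whole type that vanish outside \<open>H\<close> (so they are not linear on the whole type). Sums and integer
  multiples of functionals are pointwise; \<open>of_int k\<close> is a constant function.
\<close>

definition dual_space :: "(complex \<Rightarrow> 'a \<Rightarrow> 'a) \<Rightarrow> 'a::ab_group_add set \<Rightarrow> ('a \<Rightarrow> complex) set" where
  "dual_space s H =
     {\<mu>. (\<forall>x\<in>H. \<forall>y\<in>H. \<mu> (x + y) = \<mu> x + \<mu> y) \<and> (\<forall>a. \<forall>x\<in>H. \<mu> (s a x) = a * \<mu> x) \<and>
         (\<forall>x. x \<notin> H \<longrightarrow> \<mu> x = 0)}"

definition root_space ::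
  "('g::ab_group_add, 'z) lie_data_scheme \<Rightarrow> 'g set \<Rightarrow> ('g \<Rightarrow> complex) \<Rightarrow> 'g set" where
  "root_space G H \<alpha> = {x. \<forall>h\<in>H. brack G h x = smul G (\<alpha> h) x}"

text \<open>
  Cartan subalgebras of the reductive Lie algebra \<open>hpart G 0\<close>: self-centralizing subalgebras that
  act diagonalizably on all of \<open>G\<close>.
\<close>

definition cartan_subalgebra :: "('g::ab_group_add, 'z) lie_data_scheme \<Rightarrow> 'g set \<Rightarrow> bool" where
  "cartan_subalgebra G h0 \<longleftrightarrow>
     lsubspace (smul G) h0 \<and>
     {x \<in> hpart G 0. \<forall>h\<in>h0. brack G h x = 0} = h0 \<and>
     lspan (smul G) (\<Union>\<alpha>\<in>dual_space (smul G) h0. root_space G h0 \<alpha>) = UNIV"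

definition finite_roots :: "('g::ab_group_add, 'z) lie_data_scheme \<Rightarrow> 'g set \<Rightarrow> ('g \<Rightarrow> complex) set" where
  "finite_roots G h0 = {\<alpha> \<in> dual_space (smul G) h0. root_space G h0 \<alpha> \<noteq> {0}}"

text \<open>
  A Lie superalgebra together with a distinguished subalgebra \<open>cartan\<close>, a symmetric form \<open>cform\<close>
  (of which only the values on \<open>cartan\<close> matter), a root system, and the functional \<open>delta\<close>.
\<close>

record 'l affine_data = "'l lie_data" +
  cartan :: "'l set"
  cform :: "'l \<Rightarrow> 'l \<Rightarrow> complex"
  delta :: "'l \<Rightarrow> complex"
  roots :: "('l \<Rightarrow> complex) set"

section \<open>The loop superalgebra\<close>

text \<open>
  An element of \<open>G \<otimes> \<complex>[t, t^-1]\<close> is a finitely supported function \<open>int \<Rightarrow>\<^sub>0 'g\<close>;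
  \<open>x \<otimes> t^p\<close> is \<open>Poly_Mapping.single p x\<close>.
\<close>

definition loop_smul ::
  "('g::ab_group_add, 'z) lie_data_scheme \<Rightarrow> complex \<Rightarrow> (int \<Rightarrow>\<^sub>0 'g) \<Rightarrow> (int \<Rightarrow>\<^sub>0 'g)" where
  "loop_smul G a f = Poly_Mapping.map (smul G a) f"

definition loop_brack ::
  "('g::ab_group_add, 'z) lie_data_scheme \<Rightarrow> (int \<Rightarrow>\<^sub>0 'g) \<Rightarrow> (int \<Rightarrow>\<^sub>0 'g) \<Rightarrow> (int \<Rightarrow>\<^sub>0 'g)" where
  "loop_brack G f g =
     (\<Sum>p\<in>Poly_Mapping.keys f. \<Sum>q\<in>Poly_Mapping.keys g.
        Poly_Mapping.single (p + q) (brack G (Poly_Mapping.lookup f p) (Poly_Mapping.lookup g q)))"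

definition loop_part ::
  "('g::ab_group_add, 'z) lie_data_scheme \<Rightarrow> bit \<Rightarrow> (int \<Rightarrow>\<^sub>0 'g) set" where
  "loop_part G p = {f. \<forall>k. Poly_Mapping.lookup f k \<in> hpart G p}"

text \<open>The derivation \<open>t d/dt\<close>, i.e. \<open>x \<otimes> t^p \<mapsto> p x \<otimes> t^p\<close>.\<close>

definition loop_degree ::
  "('g::ab_group_add, 'z) lie_data_scheme \<Rightarrow> (int \<Rightarrow>\<^sub>0 'g) \<Rightarrow> (int \<Rightarrow>\<^sub>0 'g)" where
  "loop_degree G f =
     (\<Sum>p\<in>Poly_Mapping.keys f. Poly_Mapping.single p (smul G (of_int p) (Poly_Mapping.lookup f p)))"

text \<open>The cocycle \<open>(x \<otimes> t^p, y \<otimes> t^q) \<mapsto> p \<kappa>(x,y) \<delta>_{p+q,0}\<close>.\<close>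

definition loop_cocycle ::
  "('g::ab_group_add \<Rightarrow> 'g \<Rightarrow> complex) \<Rightarrow> (int \<Rightarrow>\<^sub>0 'g) \<Rightarrow> (int \<Rightarrow>\<^sub>0 'g) \<Rightarrow> complex" where
  "loop_cocycle \<kappa> f g =
     (\<Sum>p\<in>Poly_Mapping.keys f.
        of_int p * \<kappa> (Poly_Mapping.lookup f p) (Poly_Mapping.lookup g (- p)))"

lemma bilinear_map_zero:
  assumes "bilinear_map s1 s2 s3 f"
  shows "f 0 y = 0" "f x 0 = 0"
proof -
  have "Vector_Spaces.linear s1 s3 (\<lambda>x. f x y)" "Vector_Spaces.linear s2 s3 (f x)"
    using assms unfolding bilinear_map_def by blast+
  then show "f 0 y = 0" "f x 0 = 0"
    by (auto dest!: Vector_Spaces.linear.axioms(3) module_hom.zero)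
qed

lemma smul_zero_right:
  assumes "lie_superalgebra G"
  shows "smul G a 0 = 0"
proof -
  have "Vector_Spaces.vector_space (smul G)"
    using assms unfolding lie_superalgebra_def superspace_def by blast
  then interpret Vector_Spaces.vector_space "smul G" .
  show ?thesis by (rule scale_zero_right)
qed

lemma loop_smul_single:
  assumes "lie_superalgebra G"
  shows "loop_smul G a (Poly_Mapping.single p x) = Poly_Mapping.single p (smul G a x)"
  using smul_zero_right[OF assms, of a] unfolding loop_smul_def
  by (intro poly_mapping_eqI) (simp add: Poly_Mapping.map.rep_eq lookup_single when_def)

lemma loop_brack_single:
  assumes "lie_superalgebra G"
  shows "loop_brack G (Poly_Mapping.single p x) (Poly_Mapping.single q y) =
    Poly_Mapping.single (p + q) (brack G x y)"
proof -
  have "bilinear_map (smul G) (smul G) (smul G) (brack G)"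
    using assms unfolding lie_superalgebra_def by blast
  note bilinear_map_zero[OF this]
  then show ?thesis unfolding loop_brack_def by simp
qed

lemma loop_degree_single:
  assumes "lie_superalgebra G"
  shows "loop_degree G (Poly_Mapping.single p x) = Poly_Mapping.single p (smul G (of_int p) x)"
  using smul_zero_right[OF assms] unfolding loop_degree_def by auto

lemma loop_cocycle_single:
  assumes "invariant_form G \<kappa>"
  shows "loop_cocycle \<kappa> (Poly_Mapping.single p x) (Poly_Mapping.single q y) =
    (if p + q = 0 then of_int p * \<kappa> x y else 0)"
proof -
  have "bilinear_map (smul G) (smul G) (*) \<kappa>"
    using assms unfolding invariant_form_def by blast
  note bilinear_map_zero[OF this]
  moreover have "q = - p \<longleftrightarrow> p + q = 0" by arith
  ultimately show ?thesis
    unfolding loop_cocycle_def by (simp add: lookup_single when_def)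
qed

section \<open>Affinization when the type is not A(n,n)\<close>

text \<open>The triple \<open>(f, a, b)\<close> stands for \<open>f + a c + b d\<close>.\<close>

type_synonym 'g affine1 = "(int \<Rightarrow>\<^sub>0 'g) \<times> complex \<times> complex"

definition affine1_cartan :: "'g::ab_group_add set \<Rightarrow> 'g affine1 set" where
  "affine1_cartan h0 = {(Poly_Mapping.single 0 h, a, b) | h a b. h \<in> h0}"

definition affine1_ext :: "'g::ab_group_add set \<Rightarrow> ('g \<Rightarrow> complex) \<Rightarrow> 'g affine1 \<Rightarrow> complex" where
  "affine1_ext h0 \<alpha> = (\<lambda>(f, a, b).
     if (f, a, b) \<in> affine1_cartan h0 then \<alpha> (Poly_Mapping.lookup f 0) else 0)"

definition affine1_delta :: "'g::ab_group_add set \<Rightarrow> 'g affine1 \<Rightarrow> complex" where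
  "affine1_delta h0 = (\<lambda>(f, a, b). if (f, a, b) \<in> affine1_cartan h0 then b else 0)"

definition affine1 ::
  "('g::ab_group_add, 'z) lie_data_scheme \<Rightarrow> ('g \<Rightarrow> 'g \<Rightarrow> complex) \<Rightarrow> 'g set
    \<Rightarrow> 'g affine1 affine_data" where
  "affine1 G \<kappa> h0 = \<lparr>
     smul = (\<lambda>z (f, a, b). (loop_smul G z f, z * a, z * b)),
     brack = (\<lambda>(f, a, b) (g, a', b').
       (loop_brack G f g + loop_smul G b (loop_degree G g) - loop_smul G b' (loop_degree G f),
        loop_cocycle \<kappa> f g,
        0)),
     hpart = (\<lambda>p. {(f, a, b). f \<in> loop_part G p \<and> (p = 1 \<longrightarrow> a = 0 \<and> b = 0)}),
     cartan = affine1_cartan h0,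
     cform = (\<lambda>(f, a, b) (g, a', b').
       \<kappa> (Poly_Mapping.lookup f 0) (Poly_Mapping.lookup g 0) + a * b' + b * a'),
     delta = affine1_delta h0,
     roots = {affine1_ext h0 \<alpha> + of_int k * affine1_delta h0 | \<alpha> k. \<alpha> \<in> finite_roots G h0} \<rparr>"

section \<open>Affinization in type A(n,n)\<close>

definition sl_mat :: "nat \<Rightarrow> complex mat set" where
  "sl_mat n = {X \<in> carrier_mat (2 * (n + 1)) (2 * (n + 1)).
     (\<Sum>i<n + 1. X $$ (i, i)) = (\<Sum>i\<in>{n + 1..<2 * (n + 1)}. X $$ (i, i))}"

definition sl_part :: "nat \<Rightarrow> bit \<Rightarrow> complex mat set" where
  "sl_part n p = {X \<in> sl_mat n. \<forall>i<2 * (n + 1). \<forall>j<2 * (n + 1).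
     X $$ (i, j) \<noteq> 0 \<longrightarrow> (p = 0 \<longleftrightarrow> (i < n + 1 \<longleftrightarrow> j < n + 1))}"

text \<open>
  \<open>psl_projection n G \<pi>\<close> says that \<open>\<pi>\<close> exhibits \<open>G\<close> as the quotient
  \<open>psl(n+1,n+1)\<close> of \<open>sl(n+1,n+1)\<close> by the scalar matrices.
\<close>

definition psl_projection ::
  "nat \<Rightarrow> ('g::ab_group_add, 'z) lie_data_scheme \<Rightarrow> (complex mat \<Rightarrow> 'g) \<Rightarrow> bool" where
  "psl_projection n G \<pi> \<longleftrightarrow>
     (\<forall>X\<in>sl_mat n. \<forall>Y\<in>sl_mat n. \<pi> (X + Y) = \<pi> X + \<pi> Y) \<and>
     (\<forall>a. \<forall>X\<in>sl_mat n. \<pi> (a \<cdot>\<^sub>m X) = smul G a (\<pi> X)) \<and>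
     (\<forall>p q. \<forall>X\<in>sl_part n p. \<forall>Y\<in>sl_part n q.
        \<pi> (X * Y - koszul p q \<cdot>\<^sub>m (Y * X)) = brack G (\<pi> X) (\<pi> Y)) \<and>
     (\<forall>p. \<pi> ` sl_part n p = hpart G p) \<and>
     \<pi> ` sl_mat n = UNIV \<and>
     {X \<in> sl_mat n. \<pi> X = 0} = {a \<cdot>\<^sub>m 1\<^sub>m (2 * (n + 1)) | a. True}"

definition type_Ann :: "('g::ab_group_add, 'z) lie_data_scheme \<Rightarrow> bool" where
  "type_Ann G \<longleftrightarrow> (\<exists>n \<pi>. 1 \<le> n \<and> psl_projection n G \<pi>)"

definition sl_diag :: "nat \<Rightarrow> complex mat set" where
  "sl_diag n = {X \<in> sl_mat n. \<forall>i<2 * (n + 1). \<forall>j<2 * (n + 1). i \<noteq> j \<longrightarrow> X $$ (i, j) = 0}"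

definition psl_cartan :: "nat \<Rightarrow> (complex mat \<Rightarrow> 'g) \<Rightarrow> 'g set" where
  "psl_cartan n \<pi> = \<pi> ` sl_diag n"

text \<open>
  The map \<open>\<delta>^*\<close>. It is well defined on the quotient because it is zero on scalar matrices.
\<close>

definition psl_dstar :: "nat \<Rightarrow> (complex mat \<Rightarrow> 'g) \<Rightarrow> 'g \<Rightarrow> 'g" where
  "psl_dstar n \<pi> x = (THE y. \<exists>X\<in>sl_mat n. x = \<pi> X \<and>
     y = \<pi> (mat (2 * (n + 1)) (2 * (n + 1)) (\<lambda>(i, j).
           if i < n + 1 \<and> n + 1 \<le> j then X $$ (i, j)
           else if n + 1 \<le> i \<and> j < n + 1 then - X $$ (i, j)
           else 0)))"

text \<open>
  The difference of the diagonal functionals number \<open>i\<close> and \<open>j\<close>, for indices below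
  \<open>2 * (n + 1)\<close>; only such differences descend to the quotient. Indices below \<open>n + 1\<close> give the
  \<open>\<epsilon>\<close>s, the remaining ones the \<open>\<delta>\<close>s.
\<close>

definition psl_diff :: "nat \<Rightarrow> (complex mat \<Rightarrow> 'g) \<Rightarrow> nat \<Rightarrow> nat \<Rightarrow> 'g \<Rightarrow> complex" where
  "psl_diff n \<pi> i j x =
     (if x \<in> psl_cartan n \<pi>
      then THE z. \<exists>X\<in>sl_diag n. x = \<pi> X \<and> z = X $$ (i, i) - X $$ (j, j)
      else 0)"

text \<open>\<open>(f, (a1, a2), (b1, b2))\<close> stands for \<open>f + a1 c1 + a2 c2 + b1 d1 + b2 d2\<close>.\<close>

type_synonym 'g affine2 = "(int \<Rightarrow>\<^sub>0 'g) \<times> (complex \<times> complex) \<times> (complex \<times> complex)"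

definition loop_dstar ::
  "nat \<Rightarrow> (complex mat \<Rightarrow> 'g::ab_group_add) \<Rightarrow> (int \<Rightarrow>\<^sub>0 'g) \<Rightarrow> (int \<Rightarrow>\<^sub>0 'g)" where
  "loop_dstar n \<pi> f = Poly_Mapping.map (psl_dstar n \<pi>) f"

text \<open>The cocycle \<open>(x \<otimes> t^p, y \<otimes> t^q) \<mapsto> \<kappa>(\<delta>^*(x),y) \<delta>_{p+q,0} / (n+1)\<close>.\<close>

definition dstar_cocycle ::
  "nat \<Rightarrow> (complex mat \<Rightarrow> 'g::ab_group_add) \<Rightarrow> ('g \<Rightarrow> 'g \<Rightarrow> complex)
    \<Rightarrow> (int \<Rightarrow>\<^sub>0 'g) \<Rightarrow> (int \<Rightarrow>\<^sub>0 'g) \<Rightarrow> complex" where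
  "dstar_cocycle n \<pi> \<kappa> f g =
     (\<Sum>p\<in>Poly_Mapping.keys f.
        1 / of_nat (n + 1)
          * \<kappa> (psl_dstar n \<pi> (Poly_Mapping.lookup f p)) (Poly_Mapping.lookup g (- p)))"

definition affine2_cartan :: "'g::ab_group_add set \<Rightarrow> 'g affine2 set" where
  "affine2_cartan h0 = {(Poly_Mapping.single 0 h, a, b) | h a b. h \<in> h0}"

definition affine2_ext :: "'g::ab_group_add set \<Rightarrow> ('g \<Rightarrow> complex) \<Rightarrow> 'g affine2 \<Rightarrow> complex" where
  "affine2_ext h0 \<alpha> = (\<lambda>(f, a, b).
     if (f, a, b) \<in> affine2_cartan h0 then \<alpha> (Poly_Mapping.lookup f 0) else 0)"

definition affine2_sigma :: "'g::ab_group_add set \<Rightarrow> 'g affine2 \<Rightarrow> complex" where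
  "affine2_sigma h0 = (\<lambda>(f, a, b). if (f, a, b) \<in> affine2_cartan h0 then 2 * fst b else 0)"

definition affine2_delta :: "'g::ab_group_add set \<Rightarrow> 'g affine2 \<Rightarrow> complex" where
  "affine2_delta h0 = (\<lambda>(f, a, b). if (f, a, b) \<in> affine2_cartan h0 then snd b else 0)"

definition affine2_base_roots ::
  "nat \<Rightarrow> (complex mat \<Rightarrow> 'g::ab_group_add) \<Rightarrow> ('g affine2 \<Rightarrow> complex) set" where
  "affine2_base_roots n \<pi> =
     (let h0 = psl_cartan n \<pi>;
          D = (\<lambda>i j. affine2_ext h0 (psl_diff n \<pi> i j));
          E = {0..<n + 1};
          F = {n + 1..<2 * (n + 1)}
      in {D i j | i j. i \<in> E \<and> j \<in> E} \<union> {D i j | i j. i \<in> F \<and> j \<in> F}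
         \<union> {D i j + affine2_sigma h0 | i j. i \<in> E \<and> j \<in> F}
         \<union> {- (D i j + affine2_sigma h0) | i j. i \<in> E \<and> j \<in> F})"

definition affine2 ::
  "('g::ab_group_add, 'z) lie_data_scheme \<Rightarrow> ('g \<Rightarrow> 'g \<Rightarrow> complex)
    \<Rightarrow> nat \<Rightarrow> (complex mat \<Rightarrow> 'g) \<Rightarrow> 'g affine2 affine_data" where
  "affine2 G \<kappa> n \<pi> = (let h0 = psl_cartan n \<pi> in \<lparr>
     smul = (\<lambda>z (f, (a1, a2), (b1, b2)). (loop_smul G z f, (z * a1, z * a2), (z * b1, z * b2))),
     brack = (\<lambda>(f, (a1, a2), (b1, b2)) (g, (a1', a2'), (b1', b2')).
       (loop_brack G f g
          + loop_smul G (2 * b1) (loop_dstar n \<pi> g) + loop_smul G b2 (loop_degree G g)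
          - loop_smul G (2 * b1') (loop_dstar n \<pi> f) - loop_smul G b2' (loop_degree G f),
        (dstar_cocycle n \<pi> \<kappa> f g, loop_cocycle \<kappa> f g),
        (0, 0))),
     hpart = (\<lambda>p. {(f, a, b). f \<in> loop_part G p \<and> (p = 1 \<longrightarrow> a = (0, 0) \<and> b = (0, 0))}),
     cartan = affine2_cartan h0,
     cform = (\<lambda>(f, (a1, a2), (b1, b2)) (g, (a1', a2'), (b1', b2')).
       \<kappa> (Poly_Mapping.lookup f 0) (Poly_Mapping.lookup g 0)
         + a1 * b1' + b1 * a1' + a2 * b2' + b2 * a2'),
     delta = affine2_delta h0,
     roots = {\<alpha> + of_int k * affine2_delta h0 | \<alpha> k. \<alpha> \<in> affine2_base_roots n \<pi>} \<rparr>)"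

section \<open>Real roots\<close>

definition cartan_dual :: "('l::ab_group_add, 'z) affine_data_scheme \<Rightarrow> ('l \<Rightarrow> complex) set" where
  "cartan_dual L = dual_space (smul L) (cartan L)"

text \<open>The element of the Cartan subalgebra representing a functional via the form.\<close>

definition coelement :: "('l::ab_group_add, 'z) affine_data_scheme \<Rightarrow> ('l \<Rightarrow> complex) \<Rightarrow> 'l" where
  "coelement L \<alpha> = (THE t. t \<in> cartan L \<and> (\<forall>h\<in>cartan L. cform L t h = \<alpha> h))"

definition dual_form ::
  "('l::ab_group_add, 'z) affine_data_scheme \<Rightarrow> ('l \<Rightarrow> complex) \<Rightarrow> ('l \<Rightarrow> complex) \<Rightarrow> complex" where
  "dual_form L \<alpha> \<beta> = cform L (coelement L \<alpha>) (coelement L \<beta>)"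

definition real_roots :: "('l::ab_group_add, 'z) affine_data_scheme \<Rightarrow> ('l \<Rightarrow> complex) set" where
  "real_roots L = {\<alpha> \<in> roots L. dual_form L \<alpha> \<alpha> \<noteq> 0}"

section \<open>Modules\<close>

record ('l, 'm) module_data =
  msmul :: "complex \<Rightarrow> 'm \<Rightarrow> 'm"
  act :: "'l \<Rightarrow> 'm \<Rightarrow> 'm"
  mpart :: "bit \<Rightarrow> 'm set"

definition super_module ::
  "('l::ab_group_add, 'z) lie_data_scheme \<Rightarrow> ('l, 'm::ab_group_add) module_data \<Rightarrow> bool" where
  "super_module L M \<longleftrightarrow>
     superspace (msmul M) (mpart M) \<and>
     bilinear_map (smul L) (msmul M) (msmul M) (act M) \<and>
     (\<forall>p q. \<forall>x\<in>hpart L p. \<forall>v\<in>mpart M q. act M x v \<in> mpart M (p + q)) \<and>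
     (\<forall>p q. \<forall>x\<in>hpart L p. \<forall>y\<in>hpart L q. \<forall>v.
        act M (brack L x y) v =
          act M x (act M y v) - msmul M (koszul p q) (act M y (act M x v)))"

definition weight_space ::
  "('l::ab_group_add, 'z) affine_data_scheme \<Rightarrow> ('l, 'm::ab_group_add) module_data
    \<Rightarrow> ('l \<Rightarrow> complex) \<Rightarrow> 'm set" where
  "weight_space L M \<mu> = {v. \<forall>h\<in>cartan L. act M h v = msmul M (\<mu> h) v}"

text \<open>The sum of the weight spaces is automatically direct.\<close>

definition weight_module ::
  "('l::ab_group_add, 'z) affine_data_scheme \<Rightarrow> ('l, 'm::ab_group_add) module_data \<Rightarrow> bool" where
  "weight_module L M \<longleftrightarrow>
     super_module L M \<and> lspan (msmul M) (\<Union>\<mu>\<in>cartan_dual L. weight_space L M \<mu>) = UNIV"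

definition supp ::
  "('l::ab_group_add, 'z) affine_data_scheme \<Rightarrow> ('l, 'm::ab_group_add) module_data
    \<Rightarrow> ('l \<Rightarrow> complex) set" where
  "supp L M = {\<mu> \<in> cartan_dual L. weight_space L M \<mu> \<noteq> {0}}"

definition R_in ::
  "('l::ab_group_add, 'z) affine_data_scheme \<Rightarrow> ('l, 'm::ab_group_add) module_data
    \<Rightarrow> ('l \<Rightarrow> complex) set" where
  "R_in L M = {\<alpha> \<in> real_roots L. \<forall>x\<in>root_space L (cartan L) \<alpha>. x \<noteq> 0 \<longrightarrow> inj (act M x)}"

definition R_ln ::
  "('l::ab_group_add, 'z) affine_data_scheme \<Rightarrow> ('l, 'm::ab_group_add) module_data
    \<Rightarrow> ('l \<Rightarrow> complex) set" where
  "R_ln L M = {\<alpha> \<in> real_roots L. \<forall>x\<in>root_space L (cartan L) \<alpha>. x \<noteq> 0 \<longrightarrow>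
     (\<forall>v. \<exists>k. (act M x ^^ k) v = 0)}"

definition B_set ::
  "('l::ab_group_add, 'z) affine_data_scheme \<Rightarrow> ('l, 'm::ab_group_add) module_data
    \<Rightarrow> ('l \<Rightarrow> complex) set" where
  "B_set L M = {\<alpha> \<in> group_closure (roots L).
     \<forall>\<mu>\<in>supp L M. finite {k::nat. 0 < k \<and> \<mu> + of_nat k * \<alpha> \<in> supp L M}}"

definition C_set ::
  "('l::ab_group_add, 'z) affine_data_scheme \<Rightarrow> ('l, 'm::ab_group_add) module_data
    \<Rightarrow> ('l \<Rightarrow> complex) set" where
  "C_set L M = {\<alpha> \<in> group_closure (roots L). (+) \<alpha> ` supp L M \<subseteq> supp L M}"

definition has_shadow ::
  "('l::ab_group_add, 'z) affine_data_scheme \<Rightarrow> ('l, 'm::ab_group_add) module_data \<Rightarrow> bool" where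
  "has_shadow L M \<longleftrightarrow>
     weight_module L M \<and>
     real_roots L = R_in L M \<union> R_ln L M \<and>
     R_ln L M = B_set L M \<inter> real_roots L \<and>
     R_in L M = C_set L M \<inter> real_roots L"

section \<open>Behaviour along imaginary strings\<close>

definition dstring ::
  "('l, 'z) affine_data_scheme \<Rightarrow> ('l \<Rightarrow> complex) \<Rightarrow> int set \<Rightarrow> ('l \<Rightarrow> complex) set" where
  "dstring L \<alpha> K = {\<alpha> + of_int k * delta L | k. k \<in> K}"

definition string_alternatives ::
  "('l::ab_group_add, 'z) affine_data_scheme \<Rightarrow> ('l, 'm::ab_group_add) module_data
    \<Rightarrow> ('l \<Rightarrow> complex) \<Rightarrow> bool" where
  "string_alternatives L M \<beta> \<longleftrightarrow>
     dstring L \<beta> UNIV \<subseteq> R_ln L M \<or>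
     dstring L \<beta> UNIV \<subseteq> R_in L M \<or>
     (\<exists>m. \<exists>t\<in>{-1, 0, 1}. \<exists>\<gamma>. \<gamma> = \<beta> + of_int m * delta L \<and>
        dstring L \<gamma> {1..} \<subseteq> R_in L M \<and>
        dstring L \<gamma> {..0} \<subseteq> R_ln L M \<and>
        dstring L (- \<gamma>) {t..} \<subseteq> R_in L M \<and>
        dstring L (- \<gamma>) {..t - 1} \<subseteq> R_ln L M) \<or>
     (\<exists>m. \<exists>t\<in>{-1, 0, 1}. \<exists>\<eta>. \<eta> = \<beta> + of_int m * delta L \<and>
        dstring L \<eta> {..- 1} \<subseteq> R_in L M \<and>
        dstring L \<eta> {0..} \<subseteq> R_ln L M \<and>
        dstring L (- \<eta>) {..- t} \<subseteq> R_in L M \<and>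
        dstring L (- \<eta>) {1 - t..} \<subseteq> R_ln L M)"

end

(* If alpha and -alpha are real roots acting locally nilpotently, the support is invariant under the
reflection in alpha: choose homogeneous root vectors x, y whose bracket h satisfies alpha(h) /= 0 and
argue as for sl(2), or for osp(1,2) if alpha is odd. For a real root alpha such x, y exist because
the invariant form is nondegenerate, and alpha(h) is a nonzero multiple of (alpha, alpha).

Let S and T be the sets of integers k for which beta + k delta and -beta + k delta lie in R_in.
Since R_in consists of the real roots that translate the support into itself, S and T are convex,
S + T + S is contained in S, and T + S + T in T. If N is not in S and -N is not in T, the reflection
in beta + N delta gives: k is in S iff k - 2N is in T. These properties exclude bounded nonempty S
and T and leave S empty, S everything, or S and T two rays in the same direction; in the last
case at most one N is allowed, which bounds the sum of the endpoints. *)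
theory Submission
  imports Defs
begin

text \<open>After the reflection step M enters only through its support, which is reflected as a set
  of weights; no automorphism of M is constructed. A reflection moves weights, whereas S and T
  record translations, so the translation by \<gamma> is conjugated: reflect, translate, reflect
  back. The result is the translation by the reflected \<gamma>. On h the functionals \<beta> +
  k\<delta> and \<beta> + N\<delta> agree because \<delta>(h) = 0, so the reflection coefficient is
  2 for every k; this is the 2 in k - 2N. The vector h is left unnormalised. The usual eigenvalue
  conventions for sl(2) and osp(1,2) differ, but in the form "2\<lambda>(h) is an integer multiple
  of \<alpha>(h)" integrality reads the same for both, and no later step of the string argument
  depends on parity. The two kinds of affinization differ in how root vectors are supplied: by
  nondegeneracy of the form for an arbitrary Cartan subalgebra, or by matrix units, because in
  psl(2,2) the restrictions of roots to the Cartan subalgebra do not separate root vectors.\<close>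

lemma of_int_fun_apply [simp]: "of_int a x = of_int a"
  by (cases a) simp_all

section \<open>Root vectors acting on weight vectors\<close>

locale lie_supermodule =
  fixes L :: "('l::ab_group_add, 'z) affine_data_scheme"
    and M :: "('l, 'm::ab_group_add) module_data"
  assumes super: "super_module L M"
begin

sublocale vs: Vector_Spaces.vector_space "msmul M"
  using super unfolding super_module_def superspace_def by blast

lemma act_linear_right: "Vector_Spaces.linear (msmul M) (msmul M) (act M x)"
  using super unfolding super_module_def bilinear_map_def by blast

lemma act_linear_left: "Vector_Spaces.linear (smul L) (msmul M) (\<lambda>x. act M x v)"
  using super unfolding super_module_def bilinear_map_def by blast

lemma act_zero_right [simp]: "act M x 0 = 0"
  using module_hom.zero[OF Vector_Spaces.linear.axioms(3)[OF act_linear_right]] .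

lemma act_zero_left [simp]: "act M 0 v = 0"
  using module_hom.zero[OF Vector_Spaces.linear.axioms(3)[OF act_linear_left]] .

lemma act_scale_right: "act M x (msmul M a v) = msmul M a (act M x v)"
  using module_hom.scale[OF Vector_Spaces.linear.axioms(3)[OF act_linear_right]] .

lemma act_scale_left: "act M (smul L a x) v = msmul M a (act M x v)"
  using module_hom.scale[OF Vector_Spaces.linear.axioms(3)[OF act_linear_left]] by blast

lemma act_brack:
  assumes "x \<in> hpart L p" "y \<in> hpart L q"
  shows "act M (brack L x y) v = act M x (act M y v) - msmul M (koszul p q) (act M y (act M x v))"
  using super assms unfolding super_module_def by blast

text \<open>\<open>cartan L\<close> is even, so moving h past x costs no sign whatever the parity of
  x.\<close>

lemma act_root_space:
  assumes c: "cartan L \<subseteq> hpart L 0"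
    and x: "x \<in> hpart L p" "x \<in> root_space L (cartan L) \<alpha>"
    and v: "v \<in> weight_space L M \<mu>"
  shows "act M x v \<in> weight_space L M (\<mu> + \<alpha>)"
proof -
  have "act M h (act M x v) = msmul M ((\<mu> + \<alpha>) h) (act M x v)" if h: "h \<in> cartan L" for h
  proof -
    have "act M (brack L h x) v = act M h (act M x v) - msmul M (koszul 0 p) (act M x (act M h v))"
      using act_brack c h x(1) by blast
    moreover have "brack L h x = smul L (\<alpha> h) x"
      using x(2) h unfolding root_space_def by blast
    moreover have "act M h v = msmul M (\<mu> h) v"
      using v h unfolding weight_space_def by blast
    ultimately show ?thesis
      by (simp add: act_scale_left act_scale_right koszul_def vs.scale_left_distrib algebra_simps)
  qed
  then show ?thesis unfolding weight_space_def by blast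
qed

lemma funpow_act_root_space:
  assumes "cartan L \<subseteq> hpart L 0" "x \<in> hpart L p" "x \<in> root_space L (cartan L) \<alpha>"
    and "v \<in> weight_space L M \<mu>"
  shows "(act M x ^^ k) v \<in> weight_space L M (\<mu> + of_nat k * \<alpha>)"
proof (induction k)
  case 0
  then show ?case using assms(4) by simp
next
  case (Suc k)
  have "act M x ((act M x ^^ k) v) \<in> weight_space L M (\<mu> + of_nat k * \<alpha> + \<alpha>)"
    using act_root_space[OF assms(1-3) Suc] .
  moreover have "\<mu> + of_nat k * \<alpha> + \<alpha> = \<mu> + of_nat (Suc k) * \<alpha>"
    by (rule ext) (simp add: algebra_simps)
  ultimately show ?case by (simp only: funpow.simps comp_apply)
qed

end

section \<open>Ladder coefficients for sl(2) and osp(1,2)\<close>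

text \<open>
  With \<open>s = koszul p p\<close>, \<open>a = \<lambda>(h)\<close> and \<open>b = \<alpha>(h)\<close>, these are the coefficients in
  \<open>x y^(m+1) w = c_m y^m w\<close> for a vector \<open>w\<close> of weight \<open>\<lambda>\<close> with \<open>x w = 0\<close>, where \<open>h = [x, y]\<close>;
  they cover the case of \<open>sl(2)\<close> and that of \<open>osp(1,2)\<close> at once.
\<close>

primrec ladder_coeff :: "complex \<Rightarrow> complex \<Rightarrow> complex \<Rightarrow> nat \<Rightarrow> complex" where
  "ladder_coeff s a b 0 = a"
| "ladder_coeff s a b (Suc m) = a - of_nat (Suc m) * b + s * ladder_coeff s a b m"

text \<open>For s = 1 the recursion sums the arithmetic progression a - j b; doubling avoids a
  division by 2.\<close>

lemma ladder_coeff_even: "2 * ladder_coeff 1 a b m = of_nat (Suc m) * (2 * a - of_nat m * b)"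
  by (induction m) (simp_all add: algebra_simps)

text \<open>For s = -1 the same sum alternates and neighbouring terms collapse to multiples of b.
  The coefficients of odd index lose a altogether.\<close>

lemma ladder_coeff_odd:
  "ladder_coeff (- 1) a b (2 * m) = a - of_nat m * b \<and>
   ladder_coeff (- 1) a b (Suc (2 * m)) = - of_nat (Suc m) * b"
  by (induction m) (simp_all add: algebra_simps)

text \<open>In the application d is the last exponent with y^d w nonzero. For an odd root an odd d
  would make the coefficient a nonzero multiple of b, so d = 2m, and a = m b is the same equation as
  for sl(2).\<close>

lemma ladder_coeff_zero:
  assumes "ladder_coeff (koszul p p) a b d = 0" "b \<noteq> 0"
  shows "2 * a = of_nat d * b"
proof (cases "p = 1")
  case False
  have "of_nat (Suc d) * (2 * a - of_nat d * b) = 0"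
    using ladder_coeff_even[of a b d] assms(1) False by (simp add: koszul_def)
  then show ?thesis using of_nat_neq_0[of d, where 'a = complex] by simp
next
  case True
  then have z: "ladder_coeff (- 1) a b d = 0" using assms(1) by (simp add: koszul_def)
  obtain m where "d = 2 * m \<or> d = Suc (2 * m)" by (metis oddE evenE Suc_eq_plus1)
  then show ?thesis
  proof
    assume d: "d = 2 * m"
    then show ?thesis using z ladder_coeff_odd[of a b m] by simp
  next
    assume "d = Suc (2 * m)"
    then have "of_nat (Suc m) * b = 0"
      using z ladder_coeff_odd[of a b m] by (simp del: of_nat_Suc ladder_coeff.simps)
    then show ?thesis using assms(2) of_nat_neq_0[of m, where 'a = complex] by simp
  qed
qed

section \<open>Reflecting weights in a pair of opposite roots\<close>

context lie_supermodule
begin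

text \<open>x and y have equal parity, so x y = h + s y x with the same sign s at every rung. Since
  h acts on y^m w by \<mu>(h) - m \<alpha>(h), induction reproduces the recursion of
  \<open>ladder_coeff\<close>.\<close>

lemma act_ladder:
  assumes c: "cartan L \<subseteq> hpart L 0"
    and x: "x \<in> hpart L p"
    and y: "y \<in> hpart L p" "y \<in> root_space L (cartan L) (- \<alpha>)"
    and h: "brack L x y \<in> cartan L"
    and w: "w \<in> weight_space L M \<mu>" "act M x w = 0"
  shows "act M x ((act M y ^^ Suc m) w) =
    msmul M (ladder_coeff (koszul p p) (\<mu> (brack L x y)) (\<alpha> (brack L x y)) m) ((act M y ^^ m) w)"
proof (induction m)
  let ?h = "brack L x y"
  {
    fix m
    have "(act M y ^^ m) w \<in> weight_space L M (\<mu> + of_nat m * (- \<alpha>))"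
      by (rule funpow_act_root_space[OF c y w(1)])
    then have "act M ?h ((act M y ^^ m) w) = msmul M (\<mu> ?h - of_nat m * \<alpha> ?h) ((act M y ^^ m) w)"
      using h unfolding weight_space_def by simp
    moreover have "act M ?h ((act M y ^^ m) w) = act M x (act M y ((act M y ^^ m) w))
        - msmul M (koszul p p) (act M y (act M x ((act M y ^^ m) w)))"
      by (rule act_brack[OF x y(1)])
    ultimately have "act M x ((act M y ^^ Suc m) w) =
        msmul M (\<mu> ?h - of_nat m * \<alpha> ?h) ((act M y ^^ m) w)
        + msmul M (koszul p p) (act M y (act M x ((act M y ^^ m) w)))"
      by (simp add: algebra_simps)
  } note step = this
  {
    case 0
    show ?case using step[of 0] w(2) by simp
  next
    case (Suc m)
    show ?case unfolding step[of "Suc m"] Suc act_scale_right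
      by (simp add: vs.scale_left_distrib)
  }
qed

text \<open>Climb from v by k steps of x to a vector w killed by x, of weight \<nu>, then descend by
  y until the last nonzero vector y^d w. Integrality at w gives 2\<nu>(h) = d \<alpha>(h), hence a =
  d - 2k for \<mu>. The reflected weight is met on the way down when 0 \<le> a; the other sign is
  left to the exchange of x and y.\<close>

lemma reflection_nonneg:
  assumes c: "cartan L \<subseteq> hpart L 0"
    and x: "x \<in> hpart L p" "x \<in> root_space L (cartan L) \<alpha>"
    and y: "y \<in> hpart L p" "y \<in> root_space L (cartan L) (- \<alpha>)"
    and h: "brack L x y \<in> cartan L" "\<alpha> (brack L x y) \<noteq> 0"
    and nil: "\<And>v. \<exists>k. (act M x ^^ k) v = 0" "\<And>v. \<exists>k. (act M y ^^ k) v = 0"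
    and v: "v \<in> weight_space L M \<mu>" "v \<noteq> 0"
  obtains a where "2 * \<mu> (brack L x y) = of_int a * \<alpha> (brack L x y)"
    and "0 \<le> a \<Longrightarrow> weight_space L M (\<mu> - of_int a * \<alpha>) \<noteq> {0}"
proof -
  let ?h = "brack L x y"
  have last: "\<exists>k. (f ^^ k) u \<noteq> 0 \<and> f ((f ^^ k) u) = 0"
    if ex: "\<exists>k. (f ^^ k) u = 0" and ne: "u \<noteq> 0" for f :: "'m \<Rightarrow> 'm" and u
  proof -
    define k where "k = (LEAST k. (f ^^ k) u = 0)"
    have k: "(f ^^ k) u = 0" "\<And>j. j < k \<Longrightarrow> (f ^^ j) u \<noteq> 0"
      unfolding k_def using LeastI_ex[OF ex] not_less_Least by fast+
    from k(1) obtain j where "k = Suc j" using ne by (cases k) auto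
    then show ?thesis using k by auto
  qed
  obtain k where k: "(act M x ^^ k) v \<noteq> 0" "act M x ((act M x ^^ k) v) = 0"
    using last[OF nil(1) v(2)] by blast
  define w where "w = (act M x ^^ k) v"
  define \<nu> where "\<nu> = \<mu> + of_nat k * \<alpha>"
  have w: "w \<in> weight_space L M \<nu>" "act M x w = 0" "w \<noteq> 0"
    using funpow_act_root_space[OF c x v(1)] k by (auto simp: w_def \<nu>_def)
  obtain d where d: "(act M y ^^ d) w \<noteq> 0" "act M y ((act M y ^^ d) w) = 0"
    using last[OF nil(2) w(3)] by blast
  \<comment> \<open>y^(d+1) w = 0 although y^d w is nonzero, so the scalar itself must
    vanish.\<close>
  have "msmul M (ladder_coeff (koszul p p) (\<nu> ?h) (\<alpha> ?h) d) ((act M y ^^ d) w) = 0"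
    using act_ladder[OF c x(1) y h(1) w(1,2), of d] d(2) by simp
  then have "ladder_coeff (koszul p p) (\<nu> ?h) (\<alpha> ?h) d = 0" using d(1) by simp
  then have "2 * \<nu> ?h = of_nat d * \<alpha> ?h" using ladder_coeff_zero h(2) by blast
  then have e: "2 * \<mu> ?h = of_int (int d - 2 * int k) * \<alpha> ?h"
    by (simp add: \<nu>_def algebra_simps)
  define a where "a = int d - 2 * int k"
  have "weight_space L M (\<mu> - of_int a * \<alpha>) \<noteq> {0}" if a: "0 \<le> a"
  proof -
    \<comment> \<open>The way down from \<nu> to \<mu> - a\<alpha> has k + a = d - k steps; 0 \<le>
      a forces k \<le> d, so the natural subtraction is exact.\<close>
    define m where "m = d - k"
    have m: "m \<le> d" "int m = int k + a" using a unfolding m_def a_def by linarith+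
    have "(act M y ^^ (d - m)) ((act M y ^^ m) w) = (act M y ^^ d) w"
      using m(1) funpow_add[of "d - m" m "act M y"] by simp
    moreover have "(act M y ^^ j) 0 = 0" for j by (induction j) auto
    ultimately have "(act M y ^^ m) w \<noteq> 0" using d(1) by metis
    moreover have "(act M y ^^ m) w \<in> weight_space L M (\<nu> + of_nat m * (- \<alpha>))"
      by (rule funpow_act_root_space[OF c y w(1)])
    moreover have "\<nu> + of_nat m * (- \<alpha>) = \<mu> - of_int a * \<alpha>"
    proof -
      have "(of_nat m :: 'l \<Rightarrow> complex) = of_nat k + of_int a"
        using arg_cong[OF m(2), of "of_int :: int \<Rightarrow> 'l \<Rightarrow> complex"] by simp
      then show ?thesis by (simp add: \<nu>_def algebra_simps)
    qed
    ultimately show ?thesis by auto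
  qed
  then show ?thesis using that[of a] e unfolding a_def by blast
qed

text \<open>Apply the one-sided version to (x, y, \<alpha>) and to (y, x, -\<alpha>). As [y, x] is a
  nonzero multiple of [x, y], the two integers are opposite, so one of them is nonnegative, and both
  lead to the same reflected weight.\<close>

lemma reflection:
  assumes c: "cartan L \<subseteq> hpart L 0"
    and x: "x \<in> hpart L p" "x \<in> root_space L (cartan L) \<alpha>"
    and y: "y \<in> hpart L p" "y \<in> root_space L (cartan L) (- \<alpha>)"
    and h: "brack L x y \<in> cartan L" "\<alpha> (brack L x y) \<noteq> 0"
    and h': "brack L y x = smul L s (brack L x y)" "brack L y x \<in> cartan L" "s \<noteq> 0"
    and nil: "\<And>v. \<exists>k. (act M x ^^ k) v = 0" "\<And>v. \<exists>k. (act M y ^^ k) v = 0"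
    and \<mu>: "\<mu> \<in> supp L M" and \<alpha>: "\<alpha> \<in> cartan_dual L"
  obtains a where "2 * \<mu> (brack L x y) = of_int a * \<alpha> (brack L x y)"
    and "\<mu> - of_int a * \<alpha> \<in> supp L M"
proof -
  let ?h = "brack L x y"
  have scale: "\<phi> (brack L y x) = s * \<phi> ?h" if "\<phi> \<in> cartan_dual L" for \<phi>
    using that h(1) unfolding h'(1) cartan_dual_def dual_space_def by blast
  have \<mu>d: "\<mu> \<in> cartan_dual L" using \<mu> unfolding supp_def by blast
  have dual: "\<mu> - of_int a * \<alpha> \<in> cartan_dual L" for a
    using \<mu>d \<alpha> unfolding cartan_dual_def dual_space_def
    by (simp add: algebra_simps)
  have "weight_space L M \<mu> \<noteq> {0}" "0 \<in> weight_space L M \<mu>"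
    using \<mu> unfolding supp_def weight_space_def by simp_all
  then obtain v where v: "v \<in> weight_space L M \<mu>" "v \<noteq> 0" by blast
  obtain a where a: "2 * \<mu> ?h = of_int a * \<alpha> ?h"
    "0 \<le> a \<Longrightarrow> weight_space L M (\<mu> - of_int a * \<alpha>) \<noteq> {0}"
    using reflection_nonneg[OF c x y h nil v] by blast
  have x': "x \<in> root_space L (cartan L) (- (- \<alpha>))" using x(2) by simp
  have h2: "brack L y x \<in> cartan L" "(- \<alpha>) (brack L y x) \<noteq> 0"
    using h h'(2,3) scale[OF \<alpha>] by simp_all
  obtain b where b: "2 * \<mu> (brack L y x) = of_int b * (- \<alpha>) (brack L y x)"
    "0 \<le> b \<Longrightarrow> weight_space L M (\<mu> - of_int b * (- \<alpha>)) \<noteq> {0}"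
    using reflection_nonneg[OF c y x(1) x' h2 nil(2) nil(1) v] by blast
  have "2 * (s * \<mu> ?h) = of_int b * (- (s * \<alpha> ?h))"
    using b(1) scale[OF \<alpha>] scale[OF \<mu>d] by simp
  then have "s * (2 * \<mu> ?h) = s * (of_int (- b) * \<alpha> ?h)" by (simp add: mult_ac)
  then have "of_int a * \<alpha> ?h = of_int (- b) * \<alpha> ?h"
    unfolding a(1) using h'(3) mult_left_cancel by blast
  then have ab: "b = - a" using h(2)
    by (metis add.inverse_inverse mult_right_cancel of_int_eq_iff)
  have "weight_space L M (\<mu> - of_int a * \<alpha>) \<noteq> {0}"
    using a(2) b(2) unfolding ab by (cases "0 \<le> a") auto
  then show ?thesis using that[of a] a(1) dual unfolding supp_def by blast
qed

end

section \<open>Combinatorics of the two sets of integers\<close>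

text \<open>
  \<open>S\<close> and \<open>T\<close> stand for the sets of those \<open>k\<close> for which \<open>\<beta> + k \<delta>\<close>, respectively \<open>-\<beta> + k \<delta>\<close>, lies
  in \<open>R_in\<close>; \<open>refl\<close> reflects in the root \<open>\<beta> + N \<delta>\<close>.
\<close>

locale string_pair =
  fixes S T :: "int set"
  assumes convS: "\<And>i j k. i \<in> S \<Longrightarrow> k \<in> S \<Longrightarrow> i \<le> j \<Longrightarrow> j \<le> k \<Longrightarrow> j \<in> S"
    and shiftS: "\<And>i j k. i \<in> S \<Longrightarrow> j \<in> T \<Longrightarrow> k \<in> S \<Longrightarrow> i + j + k \<in> S"
    and refl: "\<And>N k. N \<notin> S \<Longrightarrow> - N \<notin> T \<Longrightarrow> k \<in> S \<longleftrightarrow> k - 2 * N \<in> T"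
begin

text \<open>Let a and b be the minimum and maximum of a bounded S. Since a + t + a and b + t + b
  stay in S, any t in T equals -a, and then a = b. Hence N = b + 1 is admissible in
  \<open>refl\<close>, and reflecting a puts into T an element different from -a.\<close>

lemma unbounded:
  assumes "S \<noteq> {}" shows "\<not> bdd_above S \<or> \<not> bdd_below S"
proof (rule ccontr)
  assume "\<not> ?thesis"
  then obtain u l where "\<And>x. x \<in> S \<Longrightarrow> x \<le> u" "\<And>x. x \<in> S \<Longrightarrow> l \<le> x"
    unfolding bdd_above_def bdd_below_def by blast
  then have "S \<subseteq> {l..u}" by auto
  then have fin: "finite S" by (rule finite_subset) simp
  define a b where "a = Min S" and "b = Max S"
  have a: "a \<in> S" "\<And>x. x \<in> S \<Longrightarrow> a \<le> x" and b: "b \<in> S" "\<And>x. x \<in> S \<Longrightarrow> x \<le> b"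
    using fin assms unfolding a_def b_def by auto
  have T: "t = - a \<and> a = b" if "t \<in> T" for t
    using a(2)[OF shiftS[OF a(1) that a(1)]] b(2)[OF shiftS[OF b(1) that b(1)]] a(2)[OF b(1)]
    by linarith
  have "b + 1 \<notin> S" "- (b + 1) \<notin> T" using b(2)[of "b + 1"] T[of "- (b + 1)"] by auto
  from refl[OF this, of a] have "a - 2 * (b + 1) \<in> T" using a(1) by simp
  from T[OF this] show False by arith
qed

text \<open>A missing point bounds a convex set on the side where it is not unbounded, so a nonempty
  proper S is a ray.\<close>

lemma cases_S:
  obtains "S = {}" | "S = UNIV" | s where "S = {s..}" | s where "S = {..s}"
proof -
  {
    assume ne: "S \<noteq> {}" "S \<noteq> UNIV"
    then obtain x y where x: "x \<in> S" and y: "y \<notin> S" by blast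
    have "(\<exists>s. S = {s..}) \<or> (\<exists>s. S = {..s})"
    proof (cases "bdd_below S")
      case True
      then obtain l where l: "\<And>z. z \<in> S \<Longrightarrow> l \<le> z" unfolding bdd_below_def by blast
      have up: "\<exists>z\<in>S. w \<le> z" for w
        using unbounded[OF ne(1)] True unfolding bdd_above_def by (meson linear)
      \<comment> \<open>S is infinite; cutting it at its element x leaves a finite set whose minimum
        is still that of S.\<close>
      have fin: "finite (S \<inter> {..x})" by (rule finite_subset[of _ "{l..x}"]) (use l in auto)
      define s where "s = Min (S \<inter> {..x})"
      have s: "s \<in> S \<inter> {..x}" "\<And>z. z \<in> S \<inter> {..x} \<Longrightarrow> s \<le> z"
        unfolding s_def using fin x by (intro Min_in Min_le; blast)+
      have "S = {s..}"
      proof (intro Set.set_eqI iffI)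
        fix z assume "z \<in> S" then show "z \<in> {s..}" using s by (cases "z \<le> x") auto
      next
        fix z assume "z \<in> {s..}"
        moreover obtain w where "w \<in> S" "z \<le> w" using up by blast
        ultimately show "z \<in> S" using convS[of s w z] s(1) by simp
      qed
      then show ?thesis by blast
    next
      case False
      have down: "\<exists>z\<in>S. z \<le> w" for w
        using False unfolding bdd_below_def by (meson linear)
      have yb: "z < y" if "z \<in> S" for z
        using down[of y] convS[OF _ that, of _ y] y by force
      have fin: "finite (S \<inter> {x..})" by (rule finite_subset[of _ "{x..y}"]) (use yb in force)+
      define s where "s = Max (S \<inter> {x..})"
      have s: "s \<in> S \<inter> {x..}" "\<And>z. z \<in> S \<inter> {x..} \<Longrightarrow> z \<le> s"
        unfolding s_def using fin x by (intro Max_in Max_ge; blast)+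
      have "S = {..s}"
      proof (intro Set.set_eqI iffI)
        fix z assume "z \<in> S" then show "z \<in> {..s}" using s by (cases "z \<ge> x") auto
      next
        fix z assume "z \<in> {..s}"
        moreover obtain w where "w \<in> S" "w \<le> z" using down by blast
        ultimately show "z \<in> S" using convS[of w s z] s(1) by simp
      qed
      then show ?thesis by blast
    qed
  }
  then show ?thesis using that by blast
qed

end

text \<open>\<open>refl\<close> is symmetric under exchanging S and T together with N and -N; only
  convexity and the shift property of T have to be supplied.\<close>

lemma string_pair_swap:
  assumes "string_pair S T"
    and "\<And>i j k. i \<in> T \<Longrightarrow> k \<in> T \<Longrightarrow> i \<le> j \<Longrightarrow> j \<le> k \<Longrightarrow> j \<in> T"
    and "\<And>i j k. i \<in> T \<Longrightarrow> j \<in> S \<Longrightarrow> k \<in> T \<Longrightarrow> i + j + k \<in> T"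
  shows "string_pair T S"
proof
  fix N k :: int assume "N \<notin> T" "- N \<notin> S"
  then show "k \<in> T \<longleftrightarrow> k - 2 * N \<in> S"
    using string_pair.refl[OF assms(1), of "- N" "k - 2 * N"] by simp
qed (use assms in blast)+

text \<open>This is the passage from \<delta> to -\<delta>; it reduces downward rays to upward
  ones.\<close>

lemma string_pair_uminus:
  assumes "string_pair S T" shows "string_pair (uminus -` S) (uminus -` T)"
proof -
  interpret string_pair S T by fact
  show ?thesis
  proof
    fix i j k :: int
    show "j \<in> uminus -` S" if "i \<in> uminus -` S" "k \<in> uminus -` S" "i \<le> j" "j \<le> k"
      using convS[of "- k" "- i" "- j"] that by simp
    show "i + j + k \<in> uminus -` S" if "i \<in> uminus -` S" "j \<in> uminus -` T" "k \<in> uminus -` S"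
      using shiftS[of "- i" "- j" "- k"] that by (simp add: algebra_simps)
    show "(j \<in> uminus -` S) = (j - 2 * k \<in> uminus -` T)"
      if "k \<notin> uminus -` S" "- k \<notin> uminus -` T"
      using refl[of "- k" "- j"] that by (simp add: algebra_simps)
  qed
qed

text \<open>Reflection at N = s - 1 excludes an empty T, and a T unbounded below would shift s out
  of S. For T = {t..} the shift property gives 0 \<le> s + t. Every N with -t < N < s is admissible
  and carries one ray onto the other, so t = s - 2N; two such N contradict each other.\<close>

lemma string_pair_atLeast:
  assumes "string_pair {s..} T" "string_pair T {s..}"
  obtains t where "T = {t..}" "s + t \<in> {0, 1, 2}"
proof -
  interpret S: string_pair "{s..}" T by fact
  interpret T: string_pair T "{s..}" by fact
  show ?thesis
  proof (cases rule: T.cases_S)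
    case 1
    then show ?thesis using S.refl[of "s - 1" s] by simp
  next
    case 2
    then show ?thesis using S.shiftS[of s "- s - 1" s] by simp
  next
    case (4 t)
    then show ?thesis using S.shiftS[of s "min t (- s - 1)" s] by simp
  next
    case (3 t)
    have "s + t \<ge> 0" using S.shiftS[of s t s] 3 by simp
    moreover have "s + t \<le> 2"
    proof (rule ccontr)
      \<comment> \<open>Now s + t is at least 3, so both s - 1 and s - 2 lie strictly between -t and
        s.\<close>
      assume g: "\<not> ?thesis"
      have "t = s - 2 * N" if "N < s" "- N < t" for N
        using S.refl[of N s] S.refl[of N "t + 2 * N"] that 3 by simp
      from this[of "s - 1"] this[of "s - 2"] g show False by simp
    qed
    ultimately have "s + t = 0 \<or> s + t = 1 \<or> s + t = 2" by arith
    then show ?thesis using that 3 by simp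
  qed
qed

lemma string_pair_atMost:
  assumes "string_pair {..s} T" "string_pair T {..s}"
  obtains t where "T = {..t}" "s + t \<in> {-2, -1, 0}"
proof -
  have neg: "uminus -` {..s} = {- s..}" by auto
  obtain t where t: "uminus -` T = {t..}" "- s + t \<in> {0, 1, 2}"
    using string_pair_atLeast[of "- s" "uminus -` T"] assms[THEN string_pair_uminus]
    unfolding neg by blast
  have "x \<in> T \<longleftrightarrow> x \<le> - t" for x
    using t(1)[THEN eq_refl[THEN subsetD], of "- x"] t(1)[THEN equalityD2, THEN subsetD, of "- x"]
    by auto
  then have "T = {..- t}" by auto
  moreover have "s + - t \<in> {-2, -1, 0}" using t(2) by auto
  ultimately show ?thesis using that by blast
qed

section \<open>Translations of the support and the alternatives along a string\<close>

text \<open>An unnormalised substitute for an sl(2) or osp(1,2) triple: of h = [x, y] only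
  \<alpha>(h) \<noteq> 0 is asked. The condition on \<open>delta L\<close> makes the value at h
  constant along each string.\<close>

definition root_triple ::
  "('l::ab_group_add, 'z) affine_data_scheme \<Rightarrow> bit \<Rightarrow> ('l \<Rightarrow> complex) \<Rightarrow> 'l \<Rightarrow> 'l \<Rightarrow> bool" where
  "root_triple L p \<alpha> x y \<longleftrightarrow>
     x \<in> hpart L p \<and> x \<in> root_space L (cartan L) \<alpha> \<and>
     y \<in> hpart L p \<and> y \<in> root_space L (cartan L) (- \<alpha>) \<and>
     brack L x y \<in> cartan L \<and> brack L y x \<in> cartan L \<and>
     brack L y x = smul L (- koszul p p) (brack L x y) \<and>
     delta L (brack L x y) = 0 \<and> \<alpha> (brack L x y) \<noteq> 0"

text \<open>Sums and multiples of real roots need not be real roots. In this monoid they can be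
  formed freely, and for modules with shadow it meets the real roots exactly in
  \<open>R_in\<close>.\<close>

definition supp_shifts ::
  "('l::ab_group_add, 'z) affine_data_scheme \<Rightarrow> ('l, 'm::ab_group_add) module_data
    \<Rightarrow> ('l \<Rightarrow> complex) set" where
  "supp_shifts L M = {\<gamma>. \<forall>\<mu>\<in>supp L M. \<mu> + \<gamma> \<in> supp L M}"

lemma supp_shifts_add:
  "\<gamma> \<in> supp_shifts L M \<Longrightarrow> \<gamma>' \<in> supp_shifts L M \<Longrightarrow> \<gamma> + \<gamma>' \<in> supp_shifts L M"
  unfolding supp_shifts_def by (auto simp flip: add.assoc)

lemma supp_shifts_mult:
  assumes "\<gamma> \<in> supp_shifts L M" shows "of_nat n * \<gamma> \<in> supp_shifts L M"
proof (induction n)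
  case 0
  have "\<mu> + of_nat 0 * \<gamma> = \<mu>" for \<mu> by (rule ext) simp
  then show ?case unfolding supp_shifts_def by (simp only: mem_Collect_eq) blast
next
  case (Suc n)
  have "of_nat (Suc n) * \<gamma> = \<gamma> + of_nat n * \<gamma>" by (rule ext) (simp add: algebra_simps)
  then show ?case using supp_shifts_add[OF assms Suc] by (simp only:)
qed

lemma R_in_iff_supp_shifts:
  assumes "has_shadow L M" "\<alpha> \<in> real_roots L"
  shows "\<alpha> \<in> R_in L M \<longleftrightarrow> \<alpha> \<in> supp_shifts L M"
proof -
  have "\<alpha> \<in> group_closure (roots L)"
    using assms(2) unfolding real_roots_def by (simp add: group_closure.base)
  moreover have "R_in L M = C_set L M \<inter> real_roots L"
    using assms(1) unfolding has_shadow_def by blast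
  ultimately show ?thesis
    using assms(2) unfolding C_set_def supp_shifts_def by (auto simp: add.commute)
qed

text \<open>A translation by n\<alpha> would place infinitely many points \<mu> + j n \<alpha> in
  the support, against the finiteness in \<open>B_set\<close>. Convexity below produces only a
  multiple of the root in question, hence the general n.\<close>

lemma R_ln_no_shift:
  assumes "has_shadow L M" "\<alpha> \<in> R_ln L M" "supp L M \<noteq> {}" "0 < n"
  shows "of_nat n * \<alpha> \<notin> supp_shifts L M"
proof
  assume t: "of_nat n * \<alpha> \<in> supp_shifts L M"
  obtain \<mu> where \<mu>: "\<mu> \<in> supp L M" using assms(3) by blast
  let ?K = "{k::nat. 0 < k \<and> \<mu> + of_nat k * \<alpha> \<in> supp L M}"
  have "\<alpha> \<in> B_set L M" using assms(1,2) unfolding has_shadow_def by blast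
  then have "finite ?K" using \<mu> unfolding B_set_def by blast
  moreover have "(\<lambda>j. Suc j * n) ` UNIV \<subseteq> ?K"
  proof (rule image_subsetI)
    fix j :: nat
    have "of_nat (Suc j) * (of_nat n * \<alpha>) \<in> supp_shifts L M" using supp_shifts_mult[OF t] .
    then have "\<mu> + of_nat (Suc j) * (of_nat n * \<alpha>) \<in> supp L M"
      using \<mu> unfolding supp_shifts_def by blast
    moreover have "\<mu> + of_nat (Suc j) * (of_nat n * \<alpha>) = \<mu> + of_nat (Suc j * n) * \<alpha>"
      by (rule ext) (simp add: algebra_simps)
    ultimately have "\<mu> + of_nat (Suc j * n) * \<alpha> \<in> supp L M" by (simp only:)
    moreover have "0 < Suc j * n" using assms(4) by simp
    ultimately show "Suc j * n \<in> ?K" by blast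
  qed
  moreover have "infinite ((\<lambda>j. Suc j * n) ` (UNIV :: nat set))"
    using finite_imageD[of "\<lambda>j. Suc j * n" UNIV] assms(4) by (auto simp: inj_on_def)
  ultimately show False using finite_subset by blast
qed

lemma R_ln_locally_nilpotent:
  assumes "has_shadow L M" "\<alpha> \<in> R_ln L M" "x \<in> root_space L (cartan L) \<alpha>"
  shows "\<exists>k. (act M x ^^ k) v = 0"
proof (cases "x = 0")
  case True
  interpret lie_supermodule L M
    using assms(1) unfolding has_shadow_def weight_module_def by unfold_locales blast
  have "(act M x ^^ 1) v = 0" using True by simp
  then show ?thesis by blast
next
  case False
  then show ?thesis using assms(2,3) unfolding R_ln_def by blast
qed

text \<open>Reflect \<mu> to \<mu> - a\<alpha>, translate by \<gamma>, reflect again. The second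
  coefficient is a - 2a + m = m - a, so a cancels and the total translation \<gamma> - m\<alpha> is
  the same for every \<mu>.\<close>

lemma supp_shifts_reflection:
  assumes sh: "has_shadow L M" and c: "cartan L \<subseteq> hpart L 0"
    and \<alpha>: "\<alpha> \<in> cartan_dual L" "\<alpha> \<in> R_ln L M" "- \<alpha> \<in> R_ln L M"
    and tri: "root_triple L p \<alpha> x y"
    and \<gamma>: "\<gamma> \<in> supp_shifts L M" "2 * \<gamma> (brack L x y) = of_int m * \<alpha> (brack L x y)"
  shows "\<gamma> - of_int m * \<alpha> \<in> supp_shifts L M"
proof -
  interpret lie_supermodule L M
    using sh unfolding has_shadow_def weight_module_def by unfold_locales blast
  let ?h = "brack L x y"
  note tri' = tri[unfolded root_triple_def]
  have ah: "\<alpha> ?h \<noteq> 0" using tri' by blast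
  have s: "- koszul p p \<noteq> 0" by (simp add: koszul_def)
  have refl: "\<exists>a. 2 * \<mu> ?h = of_int a * \<alpha> ?h \<and> \<mu> - of_int a * \<alpha> \<in> supp L M"
    if \<mu>: "\<mu> \<in> supp L M" for \<mu>
    by (rule reflection[OF c, of x p \<alpha> y "- koszul p p" \<mu>])
      (use tri' s \<mu> \<alpha> R_ln_locally_nilpotent[OF sh] in blast)+
  have uniq: "a = b" if "of_int a * \<alpha> ?h = of_int b * \<alpha> ?h" for a b :: int
    using that ah by simp
  have "\<mu> + (\<gamma> - of_int m * \<alpha>) \<in> supp L M" if \<mu>: "\<mu> \<in> supp L M" for \<mu>
  proof -
    obtain a where a: "2 * \<mu> ?h = of_int a * \<alpha> ?h" "\<mu> - of_int a * \<alpha> \<in> supp L M"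
      using refl[OF \<mu>] by blast
    have "\<mu> - of_int a * \<alpha> + \<gamma> \<in> supp L M"
      using a(2) \<gamma>(1) unfolding supp_shifts_def by blast
    then obtain b where b: "2 * (\<mu> - of_int a * \<alpha> + \<gamma>) ?h = of_int b * \<alpha> ?h"
      "\<mu> - of_int a * \<alpha> + \<gamma> - of_int b * \<alpha> \<in> supp L M"
      using refl by blast
    have "of_int b * \<alpha> ?h = of_int (m - a) * \<alpha> ?h"
      using a(1) b(1) \<gamma>(2) by (simp add: ring_distribs)
    then have "b = m - a" by (rule uniq)
    moreover have "\<mu> - of_int a * \<alpha> + \<gamma> - of_int (m - a) * \<alpha> = \<mu> + (\<gamma> - of_int m * \<alpha>)"
      by (rule ext) (simp add: algebra_simps)
    ultimately show ?thesis using b(2) by (simp only:)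
  qed
  then show ?thesis unfolding supp_shifts_def by blast
qed

text \<open>The middle root is a weighted mean of the outer two: k - j times the lower plus j - i
  times the upper one is k - i times the middle one. If the middle root were no shift it would be in
  \<open>R_ln\<close>, none of whose positive multiples is a shift.\<close>

lemma supp_shifts_convex:
  assumes sh: "has_shadow L M" and "supp L M \<noteq> {}"
    and real: "\<And>k. \<beta> + of_int k * \<delta> \<in> real_roots L"
    and ik: "\<beta> + of_int i * \<delta> \<in> supp_shifts L M" "\<beta> + of_int k * \<delta> \<in> supp_shifts L M"
    and le: "i \<le> j" "j \<le> k"
  shows "\<beta> + of_int j * \<delta> \<in> supp_shifts L M"
proof (rule ccontr)
  assume j: "\<beta> + of_int j * \<delta> \<notin> supp_shifts L M"
  then have "i \<noteq> j" using ik(1) by blast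
  then have n: "0 < nat (k - i)" using le by simp
  have "\<beta> + of_int j * \<delta> \<in> R_ln L M"
    using j real R_in_iff_supp_shifts[OF sh real] sh unfolding has_shadow_def by blast
  note nt = R_ln_no_shift[OF sh this assms(2) n]
  have "of_nat (nat (k - j)) * (\<beta> + of_int i * \<delta>) + of_nat (nat (j - i)) * (\<beta> + of_int k * \<delta>)
    = of_nat (nat (k - i)) * (\<beta> + of_int j * \<delta>)" (is "?l = ?r")
  proof (rule ext)
    fix x
    have "complex_of_nat (nat (k - j)) = of_int k - of_int j"
      "complex_of_nat (nat (j - i)) = of_int j - of_int i"
      "complex_of_nat (nat (k - i)) = of_int k - of_int i"
      using le by simp_all
    then show "?l x = ?r x"
      by (simp only: plus_fun_apply times_fun_apply of_nat_fun_apply of_int_fun_apply)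
        (simp add: algebra_simps)
  qed
  moreover have "?l \<in> supp_shifts L M"
    by (intro supp_shifts_add supp_shifts_mult ik)
  ultimately show False using nt by (simp only:)
qed

text \<open>The interface to the algebras: both affinizations have to provide only real roots along
  the two strings and a \<open>root_triple\<close> for each root of the string through
  \<beta>.\<close>

lemma string_alternatives_of_triples:
  assumes sh: "has_shadow L M" and c: "cartan L \<subseteq> hpart L 0"
    and dual: "\<beta> \<in> cartan_dual L" "delta L \<in> cartan_dual L"
    and real: "\<And>k. \<beta> + of_int k * delta L \<in> real_roots L"
      "\<And>k. - \<beta> + of_int k * delta L \<in> real_roots L"
    and tri: "\<And>k. \<exists>p x y. root_triple L p (\<beta> + of_int k * delta L) x y"
  shows "string_alternatives L M \<beta>"
proof (cases "supp L M = {}")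
  case True
  \<comment> \<open>For M = 0 the condition in \<open>B_set\<close> is vacuous, so every real root
    falls into \<open>R_ln\<close>.\<close>
  then have "real_roots L \<subseteq> R_ln L M"
    using sh unfolding has_shadow_def B_set_def real_roots_def
    by (blast intro: group_closure.base)
  then have "dstring L \<beta> UNIV \<subseteq> R_ln L M" using real unfolding dstring_def by blast
  then show ?thesis unfolding string_alternatives_def by blast
next
  case False
  let ?\<delta> = "delta L" and ?Tr = "supp_shifts L M"
  define S where "S = {k. \<beta> + of_int k * ?\<delta> \<in> ?Tr}"
  define T where "T = {k. - \<beta> + of_int k * ?\<delta> \<in> ?Tr}"
  have un: "real_roots L = R_in L M \<union> R_ln L M" using sh unfolding has_shadow_def by blast
  have in_S: "\<beta> + of_int k * ?\<delta> \<in> R_in L M" if "k \<in> S" for k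
    using that R_in_iff_supp_shifts[OF sh real(1)] unfolding S_def by blast
  have in_T: "- \<beta> + of_int k * ?\<delta> \<in> R_in L M" if "k \<in> T" for k
    using that R_in_iff_supp_shifts[OF sh real(2)] unfolding T_def by blast
  have ln_S: "\<beta> + of_int k * ?\<delta> \<in> R_ln L M" if "k \<notin> S" for k
    using that R_in_iff_supp_shifts[OF sh real(1)] un real(1) unfolding S_def by blast
  have ln_T: "- \<beta> + of_int k * ?\<delta> \<in> R_ln L M" if "k \<notin> T" for k
    using that R_in_iff_supp_shifts[OF sh real(2)] un real(2) unfolding T_def by blast
  have convT: "j \<in> T" if "i \<in> T" "k \<in> T" "i \<le> j" "j \<le> k" for i j k
    using supp_shifts_convex[OF sh False real(2)] that unfolding T_def by blast
  have shiftT: "i + j + k \<in> T" if "i \<in> T" "j \<in> S" "k \<in> T" for i j k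
  proof -
    have "- \<beta> + of_int (i + j + k) * ?\<delta> =
      (- \<beta> + of_int i * ?\<delta>) + (\<beta> + of_int j * ?\<delta>) + (- \<beta> + of_int k * ?\<delta>)"
      by (rule ext) (simp add: algebra_simps)
    moreover have "\<dots> \<in> ?Tr" using that unfolding S_def T_def by (blast intro: supp_shifts_add)
    ultimately show ?thesis unfolding T_def by (simp only: mem_Collect_eq)
  qed
  have ST: "string_pair S T"
  proof
    fix i j k :: int
    show "j \<in> S" if "i \<in> S" "k \<in> S" "i \<le> j" "j \<le> k"
      using supp_shifts_convex[OF sh False real(1)] that unfolding S_def by blast
    show "i + j + k \<in> S" if "i \<in> S" "j \<in> T" "k \<in> S"
    proof -
      have "\<beta> + of_int (i + j + k) * ?\<delta> =
        (\<beta> + of_int i * ?\<delta>) + (- \<beta> + of_int j * ?\<delta>) + (\<beta> + of_int k * ?\<delta>)"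
        by (rule ext) (simp add: algebra_simps)
      moreover have "\<dots> \<in> ?Tr" using that unfolding S_def T_def by (blast intro: supp_shifts_add)
      ultimately show ?thesis unfolding S_def by (simp only: mem_Collect_eq)
    qed
  next
    fix N k :: int
    assume N: "N \<notin> S" "- N \<notin> T"
    let ?\<alpha> = "\<beta> + of_int N * ?\<delta>"
    have m\<alpha>: "- ?\<alpha> = - \<beta> + of_int (- N) * ?\<delta>" by (rule ext) simp
    have ln: "?\<alpha> \<in> R_ln L M" "- ?\<alpha> \<in> R_ln L M"
      using ln_S[OF N(1)] ln_T[OF N(2)] unfolding m\<alpha> by blast+
    have ad: "?\<alpha> \<in> cartan_dual L"
      using dual unfolding cartan_dual_def dual_space_def by (simp add: algebra_simps)
    obtain p x y where t: "root_triple L p ?\<alpha> x y" using tri by blast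
    then have d0: "?\<delta> (brack L x y) = 0" unfolding root_triple_def by blast
    note refl = supp_shifts_reflection[OF sh c ad ln t]
    have "k \<in> S \<Longrightarrow> k - 2 * N \<in> T"
    proof -
      assume "k \<in> S"
      \<comment> \<open>At h both \<beta> + k\<delta> and the reflecting root take the same value,
        so the coefficient is 2 and \<beta> turns into -\<beta>. In the converse direction it is
        -2.\<close>
      then have "\<beta> + of_int k * ?\<delta> - of_int 2 * ?\<alpha> \<in> ?Tr"
        unfolding S_def using d0 by (intro refl) simp_all
      moreover have "\<beta> + of_int k * ?\<delta> - of_int 2 * ?\<alpha> = - \<beta> + of_int (k - 2 * N) * ?\<delta>"
        by (rule ext) (simp add: algebra_simps)
      ultimately show ?thesis unfolding T_def by (simp only: mem_Collect_eq)
    qed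
    moreover have "k - 2 * N \<in> T \<Longrightarrow> k \<in> S"
    proof -
      assume "k - 2 * N \<in> T"
      then have "- \<beta> + of_int (k - 2 * N) * ?\<delta> - of_int (- 2) * ?\<alpha> \<in> ?Tr"
        unfolding T_def using d0 by (intro refl) simp_all
      moreover have "- \<beta> + of_int (k - 2 * N) * ?\<delta> - of_int (- 2) * ?\<alpha> = \<beta> + of_int k * ?\<delta>"
        by (rule ext) (simp add: algebra_simps)
      ultimately show ?thesis unfolding S_def by (simp only: mem_Collect_eq)
    qed
    ultimately show "k \<in> S \<longleftrightarrow> k - 2 * N \<in> T" by blast
  qed
  have TS: "string_pair T S" using string_pair_swap[OF ST convT shiftT] .
  have shift: "\<beta> + of_int m * ?\<delta> + of_int k * ?\<delta> = \<beta> + of_int (m + k) * ?\<delta>"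
    "- (\<beta> + of_int m * ?\<delta>) + of_int k * ?\<delta> = - \<beta> + of_int (k - m) * ?\<delta>" for m k
    by (rule ext, simp add: algebra_simps)+
  have dS: "(\<And>k. k \<in> K \<Longrightarrow> m + k \<in> S) \<Longrightarrow> dstring L (\<beta> + of_int m * ?\<delta>) K \<subseteq> R_in L M"
    "(\<And>k. k \<in> K \<Longrightarrow> m + k \<notin> S) \<Longrightarrow> dstring L (\<beta> + of_int m * ?\<delta>) K \<subseteq> R_ln L M" for m K
    unfolding dstring_def shift using in_S ln_S by blast+
  have dT: "(\<And>k. k \<in> K \<Longrightarrow> k - m \<in> T) \<Longrightarrow> dstring L (- (\<beta> + of_int m * ?\<delta>)) K \<subseteq> R_in L M"
    "(\<And>k. k \<in> K \<Longrightarrow> k - m \<notin> T) \<Longrightarrow> dstring L (- (\<beta> + of_int m * ?\<delta>)) K \<subseteq> R_ln L M" for m K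
    unfolding dstring_def shift using in_T ln_T by blast+
  interpret string_pair S T by (rule ST)
  show ?thesis
  proof (cases rule: cases_S)
    case 1
    then have "dstring L \<beta> UNIV \<subseteq> R_ln L M" using ln_S unfolding dstring_def by blast
    then show ?thesis unfolding string_alternatives_def by blast
  next
    case 2
    then have "dstring L \<beta> UNIV \<subseteq> R_in L M" using in_S unfolding dstring_def by blast
    then show ?thesis unfolding string_alternatives_def by blast
  next
    case (3 s)
    obtain t where T: "T = {t..}" "s + t \<in> {0, 1, 2}"
      using string_pair_atLeast[OF ST[unfolded 3] TS[unfolded 3]] by blast
    \<comment> \<open>\<gamma> = \<beta> + (s - 1)\<delta> is the last root of the string outside
      \<open>R_in\<close>. Here -\<gamma> + k\<delta> is in \<open>R_in\<close> iff k - (s - 1)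
      \<ge> t, so the parameter of the statement is s + t - 1 and the range 0, 1, 2 becomes -1, 0,
      1.\<close>
    have "s + t - 1 \<in> {-1, 0, 1}" using T(2) by auto
    moreover have "dstring L (\<beta> + of_int (s - 1) * ?\<delta>) {1..} \<subseteq> R_in L M"
      using 3 by (intro dS(1)) auto
    moreover have "dstring L (\<beta> + of_int (s - 1) * ?\<delta>) {..0} \<subseteq> R_ln L M"
      using 3 by (intro dS(2)) auto
    moreover have "dstring L (- (\<beta> + of_int (s - 1) * ?\<delta>)) {s + t - 1..} \<subseteq> R_in L M"
      using T by (intro dT(1)) auto
    moreover have "dstring L (- (\<beta> + of_int (s - 1) * ?\<delta>)) {..s + t - 1 - 1} \<subseteq> R_ln L M"
      using T by (intro dT(2)) auto
    ultimately show ?thesis unfolding string_alternatives_def by blast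
  next
    case (4 s)
    obtain t where T: "T = {..t}" "s + t \<in> {-2, -1, 0}"
      using string_pair_atMost[OF ST[unfolded 4] TS[unfolded 4]] by blast
    \<comment> \<open>Mirror image: \<eta> = \<beta> + (s + 1)\<delta> is the first root outside
      \<open>R_in\<close>, and -\<eta> + k\<delta> is in \<open>R_in\<close> iff k \<le> s + t + 1,
      which the statement writes as k \<le> -t with its own t.\<close>
    have "- (s + t + 1) \<in> {-1, 0, 1}" using T(2) by auto
    moreover have "dstring L (\<beta> + of_int (s + 1) * ?\<delta>) {..- 1} \<subseteq> R_in L M"
      using 4 by (intro dS(1)) auto
    moreover have "dstring L (\<beta> + of_int (s + 1) * ?\<delta>) {0..} \<subseteq> R_ln L M"
      using 4 by (intro dS(2)) auto
    moreover have "dstring L (- (\<beta> + of_int (s + 1) * ?\<delta>)) {..- (- (s + t + 1))} \<subseteq> R_in L M"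
      using T by (intro dT(1)) auto
    moreover have "dstring L (- (\<beta> + of_int (s + 1) * ?\<delta>)) {1 - (- (s + t + 1))..} \<subseteq> R_ln L M"
      using T by (intro dT(2)) auto
    ultimately show ?thesis unfolding string_alternatives_def by blast
  qed
qed

section \<open>Root vectors in a superalgebra with a nondegenerate invariant form\<close>

lemma koszul_zero_left [simp]: "koszul 0 q = 1"
  by (simp add: koszul_def)

lemma bit_add_self [simp]: "p + p = (0 :: bit)"
  by (cases p) simp_all

locale quadratic_superalgebra =
  fixes G :: "('g::ab_group_add, 'z) lie_data_scheme" and \<kappa> :: "'g \<Rightarrow> 'g \<Rightarrow> complex"
  assumes lie: "lie_superalgebra G" and form: "invariant_form G \<kappa>"
    and nondeg: "nondegenerate_form \<kappa>"
begin

sublocale gs: Vector_Spaces.vector_space "smul G"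
  using lie unfolding lie_superalgebra_def superspace_def by blast

lemma brack_hom_left: "module_hom (smul G) (smul G) (\<lambda>x. brack G x y)"
  using lie unfolding lie_superalgebra_def bilinear_map_def
  by (blast intro: Vector_Spaces.linear.axioms(3))

lemma brack_hom_right: "module_hom (smul G) (smul G) (brack G x)"
  using lie unfolding lie_superalgebra_def bilinear_map_def
  by (blast intro: Vector_Spaces.linear.axioms(3))

lemma form_hom_left: "module_hom (smul G) (*) (\<lambda>x. \<kappa> x y)"
  using form unfolding invariant_form_def bilinear_map_def
  by (blast intro: Vector_Spaces.linear.axioms(3))

lemma form_hom_right: "module_hom (smul G) (*) (\<kappa> x)"
  using form unfolding invariant_form_def bilinear_map_def
  by (blast intro: Vector_Spaces.linear.axioms(3))

lemmas brack_linear [simp] =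
  brack_hom_left[THEN module_hom.zero] brack_hom_right[THEN module_hom.zero]
  brack_hom_left[THEN module_hom.scale] brack_hom_right[THEN module_hom.scale]
  brack_hom_left[THEN module_hom.neg] brack_hom_right[THEN module_hom.neg]

lemmas brack_add =
  brack_hom_left[THEN module_hom.add] brack_hom_right[THEN module_hom.add]

lemmas form_linear [simp] =
  form_hom_left[THEN module_hom.zero] form_hom_right[THEN module_hom.zero]
  form_hom_left[THEN module_hom.scale] form_hom_right[THEN module_hom.scale]
  form_hom_left[THEN module_hom.neg] form_hom_right[THEN module_hom.neg]

lemmas form_add = form_hom_left[THEN module_hom.add] form_hom_right[THEN module_hom.add]

lemmas form_diff = form_hom_left[THEN module_hom.diff] form_hom_right[THEN module_hom.diff]

lemma brack_part:
  "x \<in> hpart G p \<Longrightarrow> y \<in> hpart G q \<Longrightarrow> brack G x y \<in> hpart G (p + q)"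
  using lie unfolding lie_superalgebra_def by blast

lemma brack_skew:
  "x \<in> hpart G p \<Longrightarrow> y \<in> hpart G q \<Longrightarrow> brack G x y = - smul G (koszul p q) (brack G y x)"
  using lie unfolding lie_superalgebra_def by blast

lemma jacobi:
  "x \<in> hpart G p \<Longrightarrow> y \<in> hpart G q \<Longrightarrow>
    brack G x (brack G y z) =
      brack G (brack G x y) z + smul G (koszul p q) (brack G y (brack G x z))"
  using lie unfolding lie_superalgebra_def by blast

lemma part_subspace: "gs.subspace (hpart G p)"
  using lie unfolding lie_superalgebra_def superspace_def by blast

lemma part_decomp:
  obtains y z where "y \<in> hpart G 0" "z \<in> hpart G 1" "x = y + z"
  using lie unfolding lie_superalgebra_def superspace_def by blast

lemma part_Int: "x \<in> hpart G 0 \<Longrightarrow> x \<in> hpart G 1 \<Longrightarrow> x = 0"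
  using lie unfolding lie_superalgebra_def superspace_def by blast

lemma form_parity: "p \<noteq> q \<Longrightarrow> x \<in> hpart G p \<Longrightarrow> y \<in> hpart G q \<Longrightarrow> \<kappa> x y = 0"
  using form unfolding invariant_form_def by blast

lemma form_sym: "x \<in> hpart G p \<Longrightarrow> y \<in> hpart G q \<Longrightarrow> \<kappa> x y = koszul p q * \<kappa> y x"
  using form unfolding invariant_form_def by blast

lemma form_invariant: "\<kappa> (brack G x y) z = \<kappa> x (brack G y z)"
  using form unfolding invariant_form_def by blast

text \<open>For even h the Koszul sign is 1 on both homogeneous parts of x, so plain antisymmetry
  extends to inhomogeneous x.\<close>

lemma brack_even_skew:
  assumes "h \<in> hpart G 0" shows "brack G x h = - brack G h x"
proof -
  obtain y z where yz: "y \<in> hpart G 0" "z \<in> hpart G 1" "x = y + z" by (rule part_decomp)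
  have "brack G h y = - brack G y h" "brack G h z = - brack G z h"
    using brack_skew[OF assms yz(1)] brack_skew[OF assms yz(2)] by simp_all
  then show ?thesis unfolding yz(3) by (simp add: brack_add)
qed

text \<open>Invariance moves h from one argument to the other, so eigenvectors are orthogonal unless
  their eigenvalues are opposite.\<close>

lemma form_root_spaces:
  assumes "h \<in> hpart G 0" "brack G h x = smul G a x" "brack G h y = smul G b y"
  shows "(a + b) * \<kappa> x y = 0"
proof -
  have "b * \<kappa> x y = - (a * \<kappa> x y)"
    using form_invariant[of x h y] assms(2,3) by (simp add: brack_even_skew[OF assms(1)])
  then show ?thesis by (simp add: distrib_right)
qed

text \<open>The action of even h preserves parity, so the failure of y to be an eigenvector is both
  even and odd, hence zero.\<close>

lemma root_space_parts:
  assumes H: "H \<subseteq> hpart G 0" and x: "y + z \<in> root_space G H \<alpha>"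
    and yz: "y \<in> hpart G 0" "z \<in> hpart G 1"
  shows "y \<in> root_space G H \<alpha>" "z \<in> root_space G H \<alpha>"
proof -
  have "brack G h y = smul G (\<alpha> h) y \<and> brack G h z = smul G (\<alpha> h) z" if h: "h \<in> H" for h
  proof -
    have e: "brack G h y - smul G (\<alpha> h) y = - (brack G h z - smul G (\<alpha> h) z)"
      using x h unfolding root_space_def
      by (simp add: brack_add gs.scale_right_distrib algebra_simps)
    have "brack G h y - smul G (\<alpha> h) y \<in> hpart G 0"
      using brack_part[of h 0 y 0] h H yz gs.subspace_diff[OF part_subspace]
        gs.subspace_scale[OF part_subspace] by auto
    moreover have "brack G h y - smul G (\<alpha> h) y \<in> hpart G 1"
      unfolding e using brack_part[of h 0 z 1] h H yz
      by (auto intro!: gs.subspace_neg gs.subspace_diff gs.subspace_scale part_subspace)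
    ultimately have "brack G h y - smul G (\<alpha> h) y = 0" by (rule part_Int)
    then show ?thesis using e by simp
  qed
  then show "y \<in> root_space G H \<alpha>" "z \<in> root_space G H \<alpha>" unfolding root_space_def by blast+
qed

lemma form_eq_zero_on_span:
  assumes "\<And>w. w \<in> W \<Longrightarrow> \<kappa> x w = 0" "gs.span W = UNIV"
  shows "x = 0"
proof -
  have "gs.subspace {z. \<kappa> x z = 0}" by (rule gs.subspaceI) (simp_all add: form_add)
  then have "gs.span W \<subseteq> {z. \<kappa> x z = 0}" using assms(1) by (intro gs.span_minimal) auto
  then show ?thesis using assms(2) nondeg unfolding nondegenerate_form_def by blast
qed

context
  fixes H assumes cartan: "cartan_subalgebra G H"
begin

lemma cartan_sub: "gs.subspace H"
  using cartan unfolding cartan_subalgebra_def by blast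

lemma cartan_self: "x \<in> H \<longleftrightarrow> x \<in> hpart G 0 \<and> (\<forall>h\<in>H. brack G h x = 0)"
  using cartan unfolding cartan_subalgebra_def by blast

lemma cartan_even: "H \<subseteq> hpart G 0"
  using cartan_self by blast

lemma cartan_span: "gs.span (\<Union>\<alpha>\<in>dual_space (smul G) H. root_space G H \<alpha>) = UNIV"
  using cartan unfolding cartan_subalgebra_def by blast

text \<open>h has eigenvalue 0, so it is orthogonal to every root space of a nonzero functional. In
  the zero root space the even part lies in H because H is its own centralizer, and the odd part is
  orthogonal by parity.\<close>

lemma cartan_form_nondeg:
  assumes h: "h \<in> H" and z: "\<And>g. g \<in> H \<Longrightarrow> \<kappa> h g = 0"
  shows "h = 0"
proof (rule form_eq_zero_on_span[OF _ cartan_span])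
  fix w assume "w \<in> (\<Union>\<alpha>\<in>dual_space (smul G) H. root_space G H \<alpha>)"
  then obtain \<gamma> where w: "w \<in> root_space G H \<gamma>" by blast
  show "\<kappa> h w = 0"
  proof (cases "\<exists>g\<in>H. \<gamma> g \<noteq> 0")
    case True
    then obtain g where g: "g \<in> H" "\<gamma> g \<noteq> 0" by blast
    have "(0 + \<gamma> g) * \<kappa> h w = 0"
    proof (rule form_root_spaces[of g])
      show "g \<in> hpart G 0" using g(1) cartan_even by blast
      show "brack G g h = smul G 0 h" using g(1) h cartan_self[of h] by simp
      show "brack G g w = smul G (\<gamma> g) w" using g(1) w unfolding root_space_def by blast
    qed
    then show ?thesis using g(2) by simp
  next
    case False
    obtain y z' where yz: "y \<in> hpart G 0" "z' \<in> hpart G 1" "w = y + z'" by (rule part_decomp)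
    have "y \<in> root_space G H \<gamma>"
      using root_space_parts[OF cartan_even _ yz(1,2)] w yz(3) by blast
    then have "y \<in> H" using yz(1) False cartan_self[of y] unfolding root_space_def by auto
    then have "\<kappa> h y = 0" by (rule z)
    moreover have "\<kappa> h z' = 0" using form_parity[of 0 1] h cartan_even yz(2) by auto
    ultimately show ?thesis unfolding yz(3) by (simp add: form_add)
  qed
qed

text \<open>Nondegeneracy pairs a homogeneous root vector x with some root vector w, and
  orthogonality forces the functional of w to be -\<alpha>. Invariance then shows that [x, y] is
  \<kappa>(x, y) times the element of H representing \<alpha>, which links \<alpha>([x, y]) to
  (\<alpha>, \<alpha>).\<close>

lemma root_pair:
  assumes "\<alpha> \<in> finite_roots G H"
  obtains p x y where "x \<in> hpart G p" "y \<in> hpart G p" "\<kappa> x y \<noteq> 0"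
    "x \<in> root_space G H \<alpha>" "y \<in> root_space G H (- \<alpha>)" "- \<alpha> \<in> finite_roots G H"
    "brack G x y \<in> H" "\<And>h. h \<in> H \<Longrightarrow> \<kappa> (brack G x y) h = \<kappa> x y * \<alpha> h"
proof -
  have \<alpha>: "\<alpha> \<in> dual_space (smul G) H" "root_space G H \<alpha> \<noteq> {0}"
    using assms unfolding finite_roots_def by blast+
  have "0 \<in> root_space G H \<alpha>" unfolding root_space_def by simp
  then obtain x' where x': "x' \<in> root_space G H \<alpha>" "x' \<noteq> 0" using \<alpha>(2) by blast
  obtain a b where ab: "a \<in> hpart G 0" "b \<in> hpart G 1" "x' = a + b" by (rule part_decomp)
  have "a \<in> root_space G H \<alpha>" "b \<in> root_space G H \<alpha>"
    using root_space_parts[OF cartan_even _ ab(1,2)] x'(1) ab(3) by blast+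
  moreover have "a \<noteq> 0 \<or> b \<noteq> 0" using x'(2) ab(3) by auto
  ultimately obtain p x where x: "x \<in> hpart G p" "x \<in> root_space G H \<alpha>" "x \<noteq> 0"
    using ab by blast
  obtain w where w: "w \<in> (\<Union>\<alpha>\<in>dual_space (smul G) H. root_space G H \<alpha>)" "\<kappa> x w \<noteq> 0"
    using form_eq_zero_on_span[OF _ cartan_span, of x] x(3) by blast
  then obtain \<gamma> where \<gamma>: "\<gamma> \<in> dual_space (smul G) H" "w \<in> root_space G H \<gamma>" by blast
  have "\<gamma> h = - \<alpha> h" if h: "h \<in> H" for h
  proof -
    have "(\<alpha> h + \<gamma> h) * \<kappa> x w = 0"
      using x(2) \<gamma>(2) h cartan_even unfolding root_space_def by (intro form_root_spaces[of h]) blast+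
    then show ?thesis using w(2) by (simp add: eq_neg_iff_add_eq_0 add.commute)
  qed
  moreover have "\<gamma> h = - \<alpha> h" if h: "h \<notin> H" for h
    using h \<alpha>(1) \<gamma>(1) unfolding dual_space_def by simp
  ultimately have eq: "\<gamma> = - \<alpha>" by (intro ext) (auto simp: fun_Compl_def)
  obtain c d where cd: "c \<in> hpart G 0" "d \<in> hpart G 1" "w = c + d" by (rule part_decomp)
  have cdr: "c \<in> root_space G H (- \<alpha>)" "d \<in> root_space G H (- \<alpha>)"
    using root_space_parts[OF cartan_even _ cd(1,2)] \<gamma>(2) cd(3) eq by blast+
  \<comment> \<open>Parts of different parity are orthogonal, so the part of w sharing the parity of
    x carries the whole pairing.\<close>
  obtain y where y: "y \<in> hpart G p" "y \<in> root_space G H (- \<alpha>)" "\<kappa> x y \<noteq> 0"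
  proof (cases "p = 0")
    case True
    then have "\<kappa> x d = 0" using form_parity[of 0 1] x(1) cd(2) by auto
    then show ?thesis using that[of c] True cd cdr w(2) by (simp add: form_add)
  next
    case False
    then have p: "p = 1" by simp
    then have "\<kappa> x c = 0" using form_parity[of 1 0] x(1) cd(1) by auto
    then show ?thesis using that[of d] p cd cdr w(2) by (simp add: form_add)
  qed
  have T: "brack G x y \<in> H"
  proof -
    have "brack G h (brack G x y) = 0" if h: "h \<in> H" for h
      using jacobi[of h 0 x p y] h cartan_even x y(1,2) unfolding root_space_def by auto
    then show ?thesis using cartan_self[of "brack G x y"] brack_part[OF x(1) y(1)] by simp
  qed
  have form_T: "\<kappa> (brack G x y) h = \<kappa> x y * \<alpha> h" if h: "h \<in> H" for h
  proof -
    have "brack G h y = smul G (- \<alpha> h) y" using y(2) h unfolding root_space_def by simp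
    then have "brack G y h = smul G (\<alpha> h) y"
      using brack_even_skew[of h y] h cartan_even by auto
    then show ?thesis using form_invariant[of x y h] by simp
  qed
  have "- \<alpha> \<in> dual_space (smul G) H" using \<alpha>(1) unfolding dual_space_def by simp
  moreover have "y \<noteq> 0" using y(3) by auto
  ultimately have "- \<alpha> \<in> finite_roots G H" using y(2) unfolding finite_roots_def by blast
  then show ?thesis using that x y T form_T by blast
qed

end

end

section \<open>Affinization of an algebra with a given Cartan subalgebra\<close>

lemma dual_form_eq:
  assumes "t \<in> cartan L" "\<And>h. h \<in> cartan L \<Longrightarrow> cform L t h = \<alpha> h"
    and "\<And>u. u \<in> cartan L \<Longrightarrow> (\<And>h. h \<in> cartan L \<Longrightarrow> cform L u h = \<alpha> h) \<Longrightarrow> u = t"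
  shows "dual_form L \<alpha> \<alpha> = \<alpha> t"
proof -
  have "coelement L \<alpha> = t"
    unfolding coelement_def using assms by (intro the_equality) blast+
  then show ?thesis unfolding dual_form_def using assms(1,2) by simp
qed

context quadratic_superalgebra
begin

lemma loop_smul_zero_left [simp]: "loop_smul G 0 f = 0"
  unfolding loop_smul_def
  by (intro poly_mapping_eqI) (simp add: Poly_Mapping.map.rep_eq when_def)

lemmas loop_single [simp] =
  loop_smul_single[OF lie] loop_brack_single[OF lie] loop_degree_single[OF lie]
  loop_cocycle_single[OF form]

context
  fixes H assumes cartan: "cartan_subalgebra G H"
begin

lemma affine1_cartan_iff:
  "(f, a, b) \<in> affine1_cartan H \<longleftrightarrow> (\<exists>h\<in>H. f = Poly_Mapping.single 0 h)"
  unfolding affine1_cartan_def by auto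

lemma affine1_values [simp]:
  assumes "h \<in> H"
  shows "affine1_ext H \<alpha> (Poly_Mapping.single 0 h, a, b) = \<alpha> h"
    and "affine1_delta H (Poly_Mapping.single 0 h, a, b) = b"
  using assms unfolding affine1_ext_def affine1_delta_def by (auto simp: affine1_cartan_iff)

lemma affine1_even: "cartan (affine1 G \<kappa> H) \<subseteq> hpart (affine1 G \<kappa> H) 0"
  using cartan_even[OF cartan] gs.subspace_0[OF part_subspace]
  unfolding affine1_def affine1_cartan_def loop_part_def
  by (auto simp: lookup_single when_def)

lemma affine1_dual:
  assumes "\<alpha> \<in> dual_space (smul G) H"
  shows "affine1_ext H \<alpha> + of_int k * affine1_delta H \<in> cartan_dual (affine1 G \<kappa> H)"
    and "affine1_delta H \<in> cartan_dual (affine1 G \<kappa> H)"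
proof -
  have sub: "h + g \<in> H" "smul G z h \<in> H" if "h \<in> H" "g \<in> H" for h g z
    using that cartan_sub[OF cartan] gs.subspace_add gs.subspace_scale by blast+
  have \<alpha>: "\<alpha> (h + g) = \<alpha> h + \<alpha> g" "\<alpha> (smul G z h) = z * \<alpha> h" if "h \<in> H" "g \<in> H" for h g z
    using that assms unfolding dual_space_def by blast+
  have out: "affine1_ext H \<alpha> x = 0" "affine1_delta H x = 0" if "x \<notin> affine1_cartan H" for x
    using that unfolding affine1_ext_def affine1_delta_def by (auto split: prod.splits)
  show "affine1_ext H \<alpha> + of_int k * affine1_delta H \<in> cartan_dual (affine1 G \<kappa> H)"
    "affine1_delta H \<in> cartan_dual (affine1 G \<kappa> H)"
    unfolding cartan_dual_def dual_space_def affine1_def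
    using sub \<alpha> out
    by (auto simp: affine1_cartan_def algebra_simps simp flip: single_add)
qed

text \<open>Cartan elements sit in loop degree 0, where the factor p of the cocycle vanishes; d
  contributes the summand k\<delta>.\<close>

lemma affine1_root_vector:
  assumes "x \<in> root_space G H \<alpha>"
  shows "(Poly_Mapping.single k x, 0, 0) \<in>
    root_space (affine1 G \<kappa> H) (cartan (affine1 G \<kappa> H)) (affine1_ext H \<alpha> + of_int k * affine1_delta H)"
  using assms unfolding root_space_def
  by (auto simp: affine1_def affine1_cartan_def gs.scale_left_distrib mult.commute simp flip: single_add)

text \<open>Since (c, d) = 1, the functional \<delta> is represented by c, which is isotropic and
  orthogonal to T. So the value does not depend on k, and nonisotropy is a property of the whole
  string.\<close>

lemma affine1_dual_form:
  assumes T: "T \<in> H" "\<And>h. h \<in> H \<Longrightarrow> \<kappa> T h = \<alpha> h"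
  shows "dual_form (affine1 G \<kappa> H) (affine1_ext H \<alpha> + of_int k * affine1_delta H)
    (affine1_ext H \<alpha> + of_int k * affine1_delta H) = \<alpha> T"
proof -
  let ?L = "affine1 G \<kappa> H" and ?\<beta> = "affine1_ext H \<alpha> + of_int k * affine1_delta H"
  let ?t = "(Poly_Mapping.single 0 T, of_int k, 0)"
  have "dual_form ?L ?\<beta> ?\<beta> = ?\<beta> ?t"
  proof (rule dual_form_eq)
    show "?t \<in> cartan ?L" using T(1) by (auto simp: affine1_def affine1_cartan_iff)
    show "cform ?L ?t h = ?\<beta> h" if "h \<in> cartan ?L" for h
      using that T by (auto simp: affine1_def affine1_cartan_def)
  next
    fix u assume u: "u \<in> cartan ?L" and e: "\<And>h. h \<in> cartan ?L \<Longrightarrow> cform ?L u h = ?\<beta> h"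
    obtain h a b where u': "u = (Poly_Mapping.single 0 h, a, b)" "h \<in> H"
      using u by (auto simp: affine1_def affine1_cartan_def)
    have 0: "0 \<in> H" using cartan_sub[OF cartan] gs.subspace_0 by blast
    have e': "\<kappa> h g + a * b' + b * a' = \<alpha> g + of_int k * b'" if "g \<in> H" for g a' b'
      using e[of "(Poly_Mapping.single 0 g, a', b')"] that u'
      by (auto simp: affine1_def affine1_cartan_iff)
    have \<alpha>0: "\<alpha> 0 = 0" using T(2)[OF 0] by simp
    \<comment> \<open>Pairing with d and then with c reads off the two remaining
      coefficients.\<close>
    have "a = of_int k" using e'[OF 0, of 1 0] \<alpha>0 by simp
    moreover have "b = 0" using e'[OF 0, of 0 1] \<alpha>0 by simp
    moreover have "h - T = 0"
    proof (rule cartan_form_nondeg[OF cartan])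
      show "h - T \<in> H" using u'(2) T(1) cartan_sub[OF cartan] gs.subspace_diff by blast
      show "\<kappa> (h - T) g = 0" if "g \<in> H" for g
        using e'[OF that, of 0 0] T(2)[OF that] by (simp add: form_diff)
    qed
    ultimately show "u = ?t" unfolding u' by simp
  qed
  then show ?thesis using T(1) by simp
qed

text \<open>Put x in degree n + k and y in the opposite degree. Their bracket is \<open>T\<close>
  plus a multiple of c, and c is invisible to \<alpha> and \<delta>, so the triple condition reduces
  to \<alpha>(\<open>T\<close>) \<noteq> 0.\<close>

lemma affine1_alternatives:
  assumes sh: "has_shadow (affine1 G \<kappa> H) M" and \<beta>: "\<beta> \<in> real_roots (affine1 G \<kappa> H)"
  shows "string_alternatives (affine1 G \<kappa> H) M \<beta>"
proof -
  let ?L = "affine1 G \<kappa> H" and ?\<delta> = "affine1_delta H"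
  obtain \<alpha> n where \<alpha>: "\<alpha> \<in> finite_roots G H" and b: "\<beta> = affine1_ext H \<alpha> + of_int n * ?\<delta>"
    using \<beta> unfolding real_roots_def by (auto simp: affine1_def)
  have ad: "\<alpha> \<in> dual_space (smul G) H" using \<alpha> unfolding finite_roots_def by blast
  obtain p x y where xy: "x \<in> hpart G p" "y \<in> hpart G p" "\<kappa> x y \<noteq> 0"
    "x \<in> root_space G H \<alpha>" "y \<in> root_space G H (- \<alpha>)" and m\<alpha>: "- \<alpha> \<in> finite_roots G H"
    and T: "brack G x y \<in> H" "\<And>h. h \<in> H \<Longrightarrow> \<kappa> (brack G x y) h = \<kappa> x y * \<alpha> h"
    by (rule root_pair[OF cartan \<alpha>]; rule that)
  let ?T = "brack G x y" and ?c = "\<kappa> x y"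
  have sub: "smul G z ?T \<in> H" for z using T(1) cartan_sub[OF cartan] gs.subspace_scale by blast
  have \<alpha>_scale: "\<alpha> (smul G z ?T) = z * \<alpha> ?T" for z
    using ad T(1) unfolding dual_space_def by blast
  \<comment> \<open>\<open>T\<close> divided by \<kappa>(x, y) represents \<alpha>. Thus
    \<alpha>(\<open>T\<close>) is a nonzero multiple of the value of the form at \<beta>; for
    -\<alpha> the sign enters twice and cancels.\<close>
  have df: "dual_form ?L (affine1_ext H \<alpha> + of_int k * ?\<delta>) (affine1_ext H \<alpha> + of_int k * ?\<delta>) = \<alpha> ?T / ?c"
    for k
    using affine1_dual_form[OF sub[of "1 / ?c"], of \<alpha> k] T(2) xy(3) \<alpha>_scale by simp
  have dfm: "dual_form ?L (affine1_ext H (- \<alpha>) + of_int k * ?\<delta>) (affine1_ext H (- \<alpha>) + of_int k * ?\<delta>)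
    = \<alpha> ?T / ?c" for k
    using affine1_dual_form[OF sub[of "- 1 / ?c"], of "- \<alpha>" k] T(2) xy(3) \<alpha>_scale[of "- 1 / ?c"] by simp
  have nz: "\<alpha> ?T \<noteq> 0" using \<beta> df[of n] unfolding real_roots_def b by auto
  have roots: "affine1_ext H \<gamma> + of_int k * ?\<delta> \<in> roots ?L" if "\<gamma> \<in> finite_roots G H" for \<gamma> k
    using that by (auto simp: affine1_def)
  have delta: "delta ?L = ?\<delta>" by (simp add: affine1_def)
  have ext_neg: "affine1_ext H (- \<alpha>) = - affine1_ext H \<alpha>"
    by (rule ext) (auto simp: affine1_ext_def)
  have shift: "\<beta> + of_int k * ?\<delta> = affine1_ext H \<alpha> + of_int (n + k) * ?\<delta>"
    "- \<beta> + of_int k * ?\<delta> = affine1_ext H (- \<alpha>) + of_int (k - n) * ?\<delta>"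
    "- (\<beta> + of_int k * ?\<delta>) = affine1_ext H (- \<alpha>) + of_int (- (n + k)) * ?\<delta>" for k
    unfolding b ext_neg by (rule ext, simp add: algebra_simps)+
  show ?thesis
  proof (rule string_alternatives_of_triples[OF sh affine1_even])
    show "\<beta> \<in> cartan_dual ?L" unfolding b by (rule affine1_dual(1)[OF ad])
    show "delta ?L \<in> cartan_dual ?L" unfolding delta by (rule affine1_dual(2)[OF ad])
    show "\<beta> + of_int k * delta ?L \<in> real_roots ?L" for k
      unfolding delta shift real_roots_def using roots[OF \<alpha>] df nz xy(3) by (simp del: of_int_add)
    show "- \<beta> + of_int k * delta ?L \<in> real_roots ?L" for k
      unfolding delta shift real_roots_def using roots[OF m\<alpha>] dfm nz xy(3) by (simp del: of_int_diff)
    show "\<exists>p x y. root_triple ?L p (\<beta> + of_int k * delta ?L) x y" for k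
    proof -
      let ?x = "(Poly_Mapping.single (n + k) x, 0, 0) :: 'g affine1"
      let ?y = "(Poly_Mapping.single (- (n + k)) y, 0, 0) :: 'g affine1"
      have xyT: "brack ?L ?x ?y = (Poly_Mapping.single 0 ?T, of_int (n + k) * ?c, 0)"
        by (simp add: affine1_def)
      have yx: "brack G y x = smul G (- koszul p p) ?T"
        using brack_skew[OF xy(2,1)] by simp
      have "\<kappa> y x = koszul p p * ?c" using form_sym[OF xy(2,1)] .
      then have yxT: "brack ?L ?y ?x = smul ?L (- koszul p p) (brack ?L ?x ?y)"
        unfolding xyT by (simp add: affine1_def yx algebra_simps)
      have par: "?x \<in> hpart ?L p" "?y \<in> hpart ?L p"
        using xy(1,2) gs.subspace_0[OF part_subspace]
        by (auto simp: affine1_def loop_part_def lookup_single when_def)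
      have "root_triple ?L p (\<beta> + of_int k * delta ?L) ?x ?y"
        unfolding root_triple_def
      proof (intro conjI)
        show "?x \<in> root_space ?L (cartan ?L) (\<beta> + of_int k * delta ?L)"
          unfolding delta shift by (rule affine1_root_vector[OF xy(4)])
        show "?y \<in> root_space ?L (cartan ?L) (- (\<beta> + of_int k * delta ?L))"
          unfolding delta shift(3) by (rule affine1_root_vector[OF xy(5)])
        show "brack ?L ?x ?y \<in> cartan ?L"
          unfolding xyT using T(1) by (auto simp: affine1_def affine1_cartan_iff)
        show "brack ?L ?y ?x \<in> cartan ?L"
          unfolding yxT xyT using sub by (auto simp: affine1_def affine1_cartan_iff simp del: gs.scale_minus_left)
        show "delta ?L (brack ?L ?x ?y) = 0" unfolding delta xyT using T(1) by simp
        show "(\<beta> + of_int k * delta ?L) (brack ?L ?x ?y) \<noteq> 0"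
          unfolding delta shift xyT using T(1) nz by (simp del: of_int_add)
      qed (use par yxT in blast)+
      then show ?thesis by blast
    qed
  qed
qed

end

end

section \<open>Matrix computations in sl(n+1, n+1)\<close>

definition unit_mat :: "nat \<Rightarrow> nat \<Rightarrow> nat \<Rightarrow> complex mat" where
  "unit_mat n i j = mat (2 * (n + 1)) (2 * (n + 1)) (\<lambda>(a, b). if a = i \<and> b = j then 1 else 0)"

definition diag_of :: "nat \<Rightarrow> (nat \<Rightarrow> complex) \<Rightarrow> complex mat" where
  "diag_of n d = mat (2 * (n + 1)) (2 * (n + 1)) (\<lambda>(a, b). if a = b then d a else 0)"

definition index_parity :: "nat \<Rightarrow> nat \<Rightarrow> nat \<Rightarrow> bit" where
  "index_parity n i j = (if i < n + 1 \<longleftrightarrow> j < n + 1 then 0 else 1)"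

text \<open>The eigenvalue of \<open>\<delta>^*\<close> on the matrix unit number \<open>(i, j)\<close>.\<close>

definition index_degree :: "nat \<Rightarrow> nat \<Rightarrow> nat \<Rightarrow> int" where
  "index_degree n i j =
     (if i < n + 1 \<and> n + 1 \<le> j then 1 else if n + 1 \<le> i \<and> j < n + 1 then - 1 else 0)"

lemma sl_mat_dim [simp]:
  "X \<in> sl_mat n \<Longrightarrow> dim_row X = 2 * (n + 1)" "X \<in> sl_mat n \<Longrightarrow> dim_col X = 2 * (n + 1)"
  unfolding sl_mat_def by auto

lemma sl_mat_iff:
  "X \<in> sl_mat n \<longleftrightarrow> X \<in> carrier_mat (2 * (n + 1)) (2 * (n + 1)) \<and>
     sum (\<lambda>i. X $$ (i, i)) {..<n + 1} = sum (\<lambda>i. X $$ (i, i)) {n + 1..<2 * (n + 1)}"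
  unfolding sl_mat_def by blast

lemma block_subset:
  "{..<n + 1} \<subseteq> {..<2 * (n + 1)}" "{n + 1..<2 * (n + 1)} \<subseteq> {..<2 * (n + 1)}" for n :: nat
  by auto

lemma sl_mat_add:
  assumes "X \<in> sl_mat n" "Y \<in> sl_mat n" shows "X + Y \<in> sl_mat n"
proof -
  have s: "sum (\<lambda>i. (X + Y) $$ (i, i)) A = sum (\<lambda>i. X $$ (i, i)) A + sum (\<lambda>i. Y $$ (i, i)) A"
    if "A \<subseteq> {..<2 * (n + 1)}" for A
    unfolding sum.distrib[symmetric] using assms that by (intro sum.cong) auto
  note s' = s[OF block_subset(1)] s[OF block_subset(2)]
  show ?thesis
    using assms unfolding sl_mat_iff s' by (simp only: add_carrier_mat simp_thms)
qed

lemma sl_mat_smult: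
  assumes "X \<in> sl_mat n" shows "a \<cdot>\<^sub>m X \<in> sl_mat n"
proof -
  have s: "sum (\<lambda>i. (a \<cdot>\<^sub>m X) $$ (i, i)) A = a * sum (\<lambda>i. X $$ (i, i)) A"
    if "A \<subseteq> {..<2 * (n + 1)}" for A
    unfolding sum_distrib_left using assms that by (intro sum.cong) auto
  note s' = s[OF block_subset(1)] s[OF block_subset(2)]
  show ?thesis
    using assms unfolding sl_mat_iff s' by (simp only: smult_carrier_mat simp_thms)
qed

lemma sl_mat_of_diagonal:
  assumes "\<And>i. i < 2 * (n + 1) \<Longrightarrow> f (i, i) = X $$ (i, i)" "X \<in> sl_mat n"
  shows "mat (2 * (n + 1)) (2 * (n + 1)) f \<in> sl_mat n"
proof -
  have s: "sum (\<lambda>i. mat (2 * (n + 1)) (2 * (n + 1)) f $$ (i, i)) A = sum (\<lambda>i. X $$ (i, i)) A"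
    if "A \<subseteq> {..<2 * (n + 1)}" for A
    using assms that by (intro sum.cong) auto
  note s' = s[OF block_subset(1)] s[OF block_subset(2)]
  show ?thesis
    using assms(2) unfolding sl_mat_iff s' by (simp only: mat_carrier simp_thms)
qed

lemma zero_sl_mat: "mat (2 * (n + 1)) (2 * (n + 1)) (\<lambda>_. 0) \<in> sl_mat n"
  unfolding sl_mat_def by simp

lemma sl_part_sl: "X \<in> sl_part n p \<Longrightarrow> X \<in> sl_mat n"
  unfolding sl_part_def by blast

lemma sl_diag_sl: "X \<in> sl_diag n \<Longrightarrow> X \<in> sl_mat n"
  unfolding sl_diag_def by blast

lemma sl_diag_part:
  assumes "X \<in> sl_diag n" shows "X \<in> sl_part n 0"
proof -
  have "i = j" if "i < 2 * (n + 1)" "j < 2 * (n + 1)" "X $$ (i, j) \<noteq> 0" for i j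
    using that assms unfolding sl_diag_def by blast
  then show ?thesis using sl_diag_sl[OF assms] unfolding sl_part_def by blast
qed

lemma sl_diag_add: "X \<in> sl_diag n \<Longrightarrow> Y \<in> sl_diag n \<Longrightarrow> X + Y \<in> sl_diag n"
  using sl_mat_add[of X n Y] unfolding sl_diag_def by auto

lemma sl_diag_smult: "X \<in> sl_diag n \<Longrightarrow> a \<cdot>\<^sub>m X \<in> sl_diag n"
  using sl_mat_smult[of X n a] unfolding sl_diag_def by auto

lemma diag_of_sl_diag:
  assumes "(\<Sum>i<n + 1. d i) = (\<Sum>i\<in>{n + 1..<2 * (n + 1)}. d i)"
  shows "diag_of n d \<in> sl_diag n"
  using assms unfolding sl_diag_def sl_mat_def diag_of_def by simp

lemma unit_mat_part:
  assumes "i \<noteq> j" shows "unit_mat n i j \<in> sl_part n (index_parity n i j)"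
proof -
  have "unit_mat n i j \<in> sl_mat n"
    unfolding unit_mat_def by (rule sl_mat_of_diagonal[OF _ zero_sl_mat]) (use assms in auto)
  then show ?thesis
    unfolding sl_part_def index_parity_def by (auto simp: unit_mat_def split: if_splits)
qed

text \<open>Multiplying by a diagonal matrix leaves one summand per entry. The factor 1 is the
  Koszul sign of an even element, kept so that the term has the shape of the bracket in
  \<open>psl_projection\<close>.\<close>

lemma diag_bracket:
  assumes X: "X \<in> sl_diag n" and Z: "Z \<in> sl_mat n"
  shows "X * Z - 1 \<cdot>\<^sub>m (Z * X) =
    mat (2 * (n + 1)) (2 * (n + 1)) (\<lambda>(i, j). (X $$ (i, i) - X $$ (j, j)) * Z $$ (i, j))"
proof (rule eq_matI)
  note X' = sl_diag_sl[OF X]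
  have off: "X $$ (a, b) = 0" if "a < 2 * (n + 1)" "b < 2 * (n + 1)" "a \<noteq> b" for a b
    using that X unfolding sl_diag_def by blast
  fix i j
  assume "i < dim_row (mat (2 * (n + 1)) (2 * (n + 1))
      (\<lambda>(i, j). (X $$ (i, i) - X $$ (j, j)) * Z $$ (i, j)))"
    "j < dim_col (mat (2 * (n + 1)) (2 * (n + 1))
      (\<lambda>(i, j). (X $$ (i, i) - X $$ (j, j)) * Z $$ (i, j)))"
  then have ij: "i < 2 * (n + 1)" "j < 2 * (n + 1)" by simp_all
  have "(X * Z) $$ (i, j) = (\<Sum>k\<in>{0..<2 * (n + 1)}. X $$ (i, k) * Z $$ (k, j))"
    using X' Z ij by (simp add: scalar_prod_def)
  also have "\<dots> = (\<Sum>k\<in>{0..<2 * (n + 1)}. if k = i then X $$ (i, i) * Z $$ (i, j) else 0)"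
    using off ij by (intro sum.cong) auto
  finally have XZ: "(X * Z) $$ (i, j) = X $$ (i, i) * Z $$ (i, j)" using ij by simp
  have "(Z * X) $$ (i, j) = (\<Sum>k\<in>{0..<2 * (n + 1)}. Z $$ (i, k) * X $$ (k, j))"
    using X' Z ij by (simp add: scalar_prod_def)
  also have "\<dots> = (\<Sum>k\<in>{0..<2 * (n + 1)}. if k = j then Z $$ (i, j) * X $$ (j, j) else 0)"
    using off ij by (intro sum.cong) auto
  finally have ZX: "(Z * X) $$ (i, j) = Z $$ (i, j) * X $$ (j, j)" using ij by simp
  show "(X * Z - 1 \<cdot>\<^sub>m (Z * X)) $$ (i, j) = mat (2 * (n + 1)) (2 * (n + 1))
      (\<lambda>(i, j). (X $$ (i, i) - X $$ (j, j)) * Z $$ (i, j)) $$ (i, j)"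
    using XZ ZX ij X' Z by (simp add: algebra_simps)
qed (use sl_diag_sl[OF X] Z in simp_all)

lemma unit_mat_mult:
  assumes "i < 2 * (n + 1)" "j < 2 * (n + 1)" "i \<noteq> j"
  shows "unit_mat n i j * unit_mat n j i = diag_of n (\<lambda>a. if a = i then 1 else 0)"
proof (rule eq_matI)
  fix a b assume "a < dim_row (diag_of n (\<lambda>a. if a = i then 1 else 0))"
    "b < dim_col (diag_of n (\<lambda>a. if a = i then 1 else 0))"
  then have ab: "a < 2 * (n + 1)" "b < 2 * (n + 1)" by (simp_all add: diag_of_def)
  have "(unit_mat n i j * unit_mat n j i) $$ (a, b) =
    (\<Sum>k\<in>{0..<2 * (n + 1)}. unit_mat n i j $$ (a, k) * unit_mat n j i $$ (k, b))"
    using ab by (simp add: scalar_prod_def unit_mat_def)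
  also have "\<dots> = (\<Sum>k\<in>{0..<2 * (n + 1)}. if k = j then (if a = i \<and> b = i then 1 else 0) else 0)"
    using ab by (intro sum.cong) (auto simp: unit_mat_def)
  also have "\<dots> = (if a = i \<and> b = i then 1 else 0)" using assms by simp
  finally show "(unit_mat n i j * unit_mat n j i) $$ (a, b)
      = diag_of n (\<lambda>a. if a = i then 1 else 0) $$ (a, b)"
    using ab by (auto simp: diag_of_def)
qed (simp_all add: diag_of_def unit_mat_def)

lemma unit_mat_bracket:
  assumes "i < 2 * (n + 1)" "j < 2 * (n + 1)" "i \<noteq> j"
  shows "unit_mat n i j * unit_mat n j i - s \<cdot>\<^sub>m (unit_mat n j i * unit_mat n i j) =
    diag_of n (\<lambda>a. if a = i then 1 else if a = j then - s else 0)"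
  using assms by (subst (1 2) unit_mat_mult) (auto simp: diag_of_def)

text \<open>For indices in one block the entries 1 and -1 cancel in a single trace; for indices in
  different blocks the Koszul sign is -1 and each block trace receives a 1.\<close>

lemma unit_bracket_sl_diag:
  assumes "i < 2 * (n + 1)" "j < 2 * (n + 1)" "i \<noteq> j"
  shows "diag_of n (\<lambda>a. if a = i then 1 else if a = j then - koszul (index_parity n i j) (index_parity n i j) else 0)
    \<in> sl_diag n"
proof (rule diag_of_sl_diag)
  let ?s = "koszul (index_parity n i j) (index_parity n i j)"
  have e: "(if a = i then 1 else if a = j then - ?s else 0) =
    (if a = i then 1 else 0) + (if a = j then - ?s else (0 :: complex))" for a
    using assms(3) by simp
  show "(\<Sum>a<n + 1. if a = i then 1 else if a = j then - ?s else 0) =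
    (\<Sum>a\<in>{n + 1..<2 * (n + 1)}. if a = i then 1 else if a = j then - ?s else 0)"
    unfolding e sum.distrib using assms
    by (simp only: sum.delta finite_lessThan finite_atLeastLessThan)
      (auto simp: koszul_def index_parity_def)
qed

text \<open>
  A diagonal matrix with pairwise distinct entries: both blocks have trace zero, and the factor
  \<open>\<i>\<close> keeps the entries of the two blocks apart.
\<close>

definition distinct_diag :: "nat \<Rightarrow> complex mat" where
  "distinct_diag n = diag_of n (\<lambda>i.
     let s = (\<lambda>k. if k < n then of_nat (k + 1) else - (\<Sum>l<n. of_nat (l + 1)))
     in if i < n + 1 then s i else \<i> * s (i - (n + 1)))"

lemma distinct_diag_sl_diag: "distinct_diag n \<in> sl_diag n"
proof -
  define s :: "nat \<Rightarrow> complex" where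
    "s = (\<lambda>k. if k < n then of_nat (k + 1) else - (\<Sum>l<n. of_nat (l + 1)))"
  have s0: "(\<Sum>k<n + 1. s k) = 0" by (simp add: s_def)
  have "(\<Sum>i\<in>{n + 1..<2 * (n + 1)}. if i < n + 1 then s i else \<i> * s (i - (n + 1)))
    = (\<Sum>i\<in>{0 + (n + 1)..<(n + 1) + (n + 1)}. \<i> * s (i - (n + 1)))"
    by (intro sum.cong) auto
  also have "\<dots> = (\<Sum>i\<in>{0..<n + 1}. \<i> * s i)"
    by (subst sum.shift_bounds_nat_ivl) (intro sum.cong, auto)
  also have "\<dots> = 0" using s0 by (simp flip: sum_distrib_left add: lessThan_atLeast0)
  finally have b: "(\<Sum>i\<in>{n + 1..<2 * (n + 1)}. if i < n + 1 then s i else \<i> * s (i - (n + 1))) = 0" .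
  have "(\<Sum>i<n + 1. if i < n + 1 then s i else \<i> * s (i - (n + 1))) = (\<Sum>i<n + 1. s i)"
    by (intro sum.cong) auto
  then show ?thesis
    unfolding distinct_diag_def Let_def s_def[symmetric]
    by (intro diag_of_sl_diag) (simp only: b s0)
qed

text \<open>Within a block the entries are distinct positive numbers and one negative number, up to
  the common factor. Across blocks a nonzero real meets a nonzero imaginary number; 1 \<le> n keeps
  the last entry of each block nonzero.\<close>

lemma distinct_diag_entries:
  assumes n: "1 \<le> n" and ij: "i < 2 * (n + 1)" "j < 2 * (n + 1)" "i \<noteq> j"
  shows "distinct_diag n $$ (i, i) \<noteq> distinct_diag n $$ (j, j)"
proof -
  define s :: "nat \<Rightarrow> real" where
    "s = (\<lambda>k. if k < n then of_nat (k + 1) else - (\<Sum>l<n. of_nat (l + 1)))"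
  have pos: "0 < (\<Sum>l<n. real (l + 1))" using n by (intro sum_pos) (auto simp: lessThan_empty_iff)
  have s_nz: "s k \<noteq> 0" for k using pos by (simp add: s_def)
  have s_inj: "k = l" if "s k = s l" "k < n + 1" "l < n + 1" for k l
    using that pos unfolding s_def by (auto split: if_splits)
  have e: "distinct_diag n $$ (i, i) =
    (if i < n + 1 then of_real (s i) else \<i> * of_real (s (i - (n + 1))))"
    if "i < 2 * (n + 1)" for i
    using that by (simp add: distinct_diag_def diag_of_def s_def)
  have "i - (n + 1) < n + 1" "j - (n + 1) < n + 1" using ij by arith+
  moreover have "i - (n + 1) \<noteq> j - (n + 1)" if "\<not> i < n + 1" "\<not> j < n + 1"
    using that ij(3) by arith
  ultimately show ?thesis
    unfolding e[OF ij(1)] e[OF ij(2)]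
    using s_nz[of i] s_nz[of j] s_inj[of i j] s_inj[of "i - (n + 1)" "j - (n + 1)"] ij
    by (auto simp: complex_eq_iff)
qed

section \<open>The quotient psl(n+1, n+1) and its root vectors\<close>

locale psl_superalgebra = quadratic_superalgebra G \<kappa>
  for G :: "('g::ab_group_add, 'z) lie_data_scheme" and \<kappa> +
  fixes n :: nat and \<pi> :: "complex mat \<Rightarrow> 'g"
  assumes n: "1 \<le> n" and psl: "psl_projection n G \<pi>"
begin

abbreviation "H \<equiv> psl_cartan n \<pi>"

lemma psl_add: "X \<in> sl_mat n \<Longrightarrow> Y \<in> sl_mat n \<Longrightarrow> \<pi> (X + Y) = \<pi> X + \<pi> Y"
  using psl[unfolded psl_projection_def, THEN conjunct1] by blast

lemma psl_scale: "X \<in> sl_mat n \<Longrightarrow> \<pi> (a \<cdot>\<^sub>m X) = smul G a (\<pi> X)"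
  using psl[unfolded psl_projection_def, THEN conjunct2, THEN conjunct1] by blast

lemma psl_brack:
  "X \<in> sl_part n p \<Longrightarrow> Y \<in> sl_part n q \<Longrightarrow>
    brack G (\<pi> X) (\<pi> Y) = \<pi> (X * Y - koszul p q \<cdot>\<^sub>m (Y * X))"
  using psl[unfolded psl_projection_def, THEN conjunct2, THEN conjunct2, THEN conjunct1] by simp

lemma psl_part: "\<pi> ` sl_part n p = hpart G p"
  using psl[unfolded psl_projection_def, THEN conjunct2, THEN conjunct2, THEN conjunct2, THEN conjunct1] by blast

lemma psl_kernel:
  "X \<in> sl_mat n \<Longrightarrow> \<pi> X = 0 \<longleftrightarrow> (\<exists>a. X = a \<cdot>\<^sub>m 1\<^sub>m (2 * (n + 1)))"
  using psl[unfolded psl_projection_def, THEN conjunct2, THEN conjunct2, THEN conjunct2, THEN conjunct2, THEN conjunct2] by blast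

lemma psl_zero: "\<pi> (mat (2 * (n + 1)) (2 * (n + 1)) (\<lambda>_. 0)) = 0"
proof -
  have "mat (2 * (n + 1)) (2 * (n + 1)) (\<lambda>_. 0) = 0 \<cdot>\<^sub>m (1\<^sub>m (2 * (n + 1)) :: complex mat)"
    by (rule eq_matI) simp_all
  then show ?thesis using psl_kernel[OF zero_sl_mat] by blast
qed

text \<open>Off-diagonal entries and differences of diagonal entries do not see a scalar matrix.
  This makes the definite descriptions in \<open>psl_diff\<close> and \<open>psl_dstar\<close>
  independent of the representative.\<close>

lemma psl_eqD:
  assumes "X \<in> sl_mat n" "Y \<in> sl_mat n" "\<pi> X = \<pi> Y"
  obtains a where "\<And>i j. i < 2 * (n + 1) \<Longrightarrow> j < 2 * (n + 1) \<Longrightarrow>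
    Y $$ (i, j) = X $$ (i, j) + (if i = j then a else 0)"
proof -
  have m: "(- 1) \<cdot>\<^sub>m X \<in> sl_mat n" by (rule sl_mat_smult[OF assms(1)])
  have "\<pi> (Y + (- 1) \<cdot>\<^sub>m X) = 0"
    using psl_add[OF assms(2) m] psl_scale[OF assms(1)] assms(3) by simp
  then obtain a where a: "Y + (- 1) \<cdot>\<^sub>m X = a \<cdot>\<^sub>m 1\<^sub>m (2 * (n + 1))"
    using psl_kernel[OF sl_mat_add[OF assms(2) m]] by blast
  have "Y $$ (i, j) = X $$ (i, j) + (if i = j then a else 0)"
    if "i < 2 * (n + 1)" "j < 2 * (n + 1)" for i j
    using arg_cong[OF a, of "\<lambda>A. A $$ (i, j)"] that assms(1,2) by (auto simp: algebra_simps split: if_splits)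
  then show ?thesis using that by blast
qed

lemma psl_cartanE:
  assumes "h \<in> H" obtains X where "X \<in> sl_diag n" "h = \<pi> X"
  using assms unfolding psl_cartan_def by blast

lemma psl_cartanI: "X \<in> sl_diag n \<Longrightarrow> \<pi> X \<in> H"
  unfolding psl_cartan_def by blast

lemma psl_cartan_even: "H \<subseteq> hpart G 0"
  using psl_part[of 0] sl_diag_part unfolding psl_cartan_def by blast

lemma psl_cartan_subspace: "gs.subspace H"
proof (rule gs.subspaceI)
  have "mat (2 * (n + 1)) (2 * (n + 1)) (\<lambda>_. 0) \<in> sl_diag n"
    using zero_sl_mat[of n] unfolding sl_diag_def by simp
  then show "0 \<in> H" using psl_cartanI psl_zero by metis
  show "h + g \<in> H" if hg: "h \<in> H" "g \<in> H" for h g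
  proof -
    obtain X Y where "X \<in> sl_diag n" "h = \<pi> X" "Y \<in> sl_diag n" "g = \<pi> Y"
      using hg by (meson psl_cartanE)
    then show ?thesis
      using psl_add[OF sl_diag_sl sl_diag_sl] psl_cartanI[OF sl_diag_add] by metis
  qed
  show "smul G a h \<in> H" if h: "h \<in> H" for a h
  proof -
    obtain X where "X \<in> sl_diag n" "h = \<pi> X" using h by (rule psl_cartanE)
    then show ?thesis using psl_scale[OF sl_diag_sl] psl_cartanI[OF sl_diag_smult] by metis
  qed
qed

lemma psl_diff_diag:
  assumes X: "X \<in> sl_diag n" and ij: "i < 2 * (n + 1)" "j < 2 * (n + 1)"
  shows "psl_diff n \<pi> i j (\<pi> X) = X $$ (i, i) - X $$ (j, j)"
proof -
  have "(THE z. \<exists>Y\<in>sl_diag n. \<pi> X = \<pi> Y \<and> z = Y $$ (i, i) - Y $$ (j, j)) = X $$ (i, i) - X $$ (j, j)"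
  proof (rule the_equality)
    fix z assume "\<exists>Y\<in>sl_diag n. \<pi> X = \<pi> Y \<and> z = Y $$ (i, i) - Y $$ (j, j)"
    then obtain Y where Y: "Y \<in> sl_diag n" "\<pi> X = \<pi> Y" "z = Y $$ (i, i) - Y $$ (j, j)" by blast
    obtain a where "\<And>i j. i < 2 * (n + 1) \<Longrightarrow> j < 2 * (n + 1) \<Longrightarrow>
        Y $$ (i, j) = X $$ (i, j) + (if i = j then a else 0)"
      using psl_eqD[OF sl_diag_sl[OF X] sl_diag_sl[OF Y(1)] Y(2)] by blast
    then show "z = X $$ (i, i) - X $$ (j, j)" unfolding Y(3) using ij by simp
  qed (use X in blast)
  then show ?thesis unfolding psl_diff_def using psl_cartanI[OF X] by simp
qed

lemma psl_dstar_eq: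
  assumes X: "X \<in> sl_mat n"
  shows "psl_dstar n \<pi> (\<pi> X) = \<pi> (mat (2 * (n + 1)) (2 * (n + 1)) (\<lambda>(i, j).
           if i < n + 1 \<and> n + 1 \<le> j then X $$ (i, j)
           else if n + 1 \<le> i \<and> j < n + 1 then - X $$ (i, j)
           else 0))" (is "_ = \<pi> (?b X)")
  unfolding psl_dstar_def
proof (rule the_equality)
  fix y assume "\<exists>Y\<in>sl_mat n. \<pi> X = \<pi> Y \<and> y = \<pi> (?b Y)"
  then obtain Y where Y: "Y \<in> sl_mat n" "\<pi> X = \<pi> Y" "y = \<pi> (?b Y)" by blast
  obtain a where a: "\<And>i j. i < 2 * (n + 1) \<Longrightarrow> j < 2 * (n + 1) \<Longrightarrow>
      Y $$ (i, j) = X $$ (i, j) + (if i = j then a else 0)"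
    using psl_eqD[OF X Y(1,2)] by blast
  have "?b Y = ?b X" by (rule eq_matI) (use a in auto)
  then show "y = \<pi> (?b X)" using Y(3) by simp
qed (use X in blast)

lemma psl_dstar_even:
  assumes "h \<in> hpart G 0" shows "psl_dstar n \<pi> h = 0"
proof -
  obtain X where X: "X \<in> sl_part n 0" "h = \<pi> X" using assms psl_part[of 0] by blast
  have "X $$ (i, j) = 0" if "i < 2 * (n + 1)" "j < 2 * (n + 1)" "(i < n + 1) \<noteq> (j < n + 1)" for i j
    using that X(1) unfolding sl_part_def by blast
  then have "mat (2 * (n + 1)) (2 * (n + 1)) (\<lambda>(i, j).
           if i < n + 1 \<and> n + 1 \<le> j then X $$ (i, j)
           else if n + 1 \<le> i \<and> j < n + 1 then - X $$ (i, j)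
           else 0) = mat (2 * (n + 1)) (2 * (n + 1)) (\<lambda>_. 0)"
    by (intro eq_matI) simp_all
  then show ?thesis unfolding X(2) psl_dstar_eq[OF sl_part_sl[OF X(1)]] using psl_zero by simp
qed

lemma psl_dstar_unit:
  assumes "i \<noteq> j"
  shows "psl_dstar n \<pi> (\<pi> (unit_mat n i j)) = smul G (of_int (index_degree n i j)) (\<pi> (unit_mat n i j))"
proof -
  have sl: "unit_mat n i j \<in> sl_mat n" using unit_mat_part[OF assms] by (rule sl_part_sl)
  have "mat (2 * (n + 1)) (2 * (n + 1)) (\<lambda>(a, b).
           if a < n + 1 \<and> n + 1 \<le> b then unit_mat n i j $$ (a, b)
           else if n + 1 \<le> a \<and> b < n + 1 then - unit_mat n i j $$ (a, b)
           else 0) = of_int (index_degree n i j) \<cdot>\<^sub>m unit_mat n i j"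
    by (rule eq_matI) (auto simp: unit_mat_def index_degree_def)
  then show ?thesis using psl_dstar_eq[OF sl] psl_scale[OF sl] by metis
qed

lemma psl_diag_brack:
  assumes "X \<in> sl_diag n" "Z \<in> sl_part n p"
  shows "brack G (\<pi> X) (\<pi> Z) =
    \<pi> (mat (2 * (n + 1)) (2 * (n + 1)) (\<lambda>(i, j). (X $$ (i, i) - X $$ (j, j)) * Z $$ (i, j)))"
  using psl_brack[OF sl_diag_part[OF assms(1)] assms(2)]
    diag_bracket[OF assms(1) sl_part_sl[OF assms(2)]] by simp

lemma psl_root_vector:
  assumes h: "h \<in> H" and ij: "i < 2 * (n + 1)" "j < 2 * (n + 1)" "i \<noteq> j"
  shows "brack G h (\<pi> (unit_mat n i j)) = smul G (psl_diff n \<pi> i j h) (\<pi> (unit_mat n i j))"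
proof -
  obtain X where X: "X \<in> sl_diag n" "h = \<pi> X" using h by (rule psl_cartanE)
  have "mat (2 * (n + 1)) (2 * (n + 1)) (\<lambda>(a, b). (X $$ (a, a) - X $$ (b, b)) * unit_mat n i j $$ (a, b))
    = (X $$ (i, i) - X $$ (j, j)) \<cdot>\<^sub>m unit_mat n i j"
    by (rule eq_matI) (auto simp: unit_mat_def)
  then show ?thesis
    using psl_diag_brack[OF X(1) unit_mat_part[OF ij(3)]]
      psl_scale[OF sl_part_sl[OF unit_mat_part[OF ij(3)]]] psl_diff_diag[OF X(1) ij(1,2)] X(2)
    by metis
qed

lemma psl_cartan_commute:
  assumes "h \<in> H" "g \<in> H" shows "brack G h g = 0"
proof -
  obtain X Y where X: "X \<in> sl_diag n" "h = \<pi> X" and Y: "Y \<in> sl_diag n" "g = \<pi> Y"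
    using assms by (meson psl_cartanE)
  have "mat (2 * (n + 1)) (2 * (n + 1)) (\<lambda>(i, j). (X $$ (i, i) - X $$ (j, j)) * Y $$ (i, j))
    = mat (2 * (n + 1)) (2 * (n + 1)) (\<lambda>_. 0)"
    using Y(1) unfolding sl_diag_def by (intro eq_matI) auto
  then show ?thesis
    using psl_diag_brack[OF X(1) sl_diag_part[OF Y(1)]] X(2) Y(2) psl_zero by metis
qed

text \<open>
  An even element is the sum of a diagonal one and one in the image of the adjoint action of a
  diagonal matrix with distinct entries; the latter part is orthogonal to the Cartan subalgebra.
\<close>

lemma psl_cartan_form_nondeg:
  assumes h: "h \<in> H" and z: "\<And>g. g \<in> H \<Longrightarrow> \<kappa> h g = 0"
  shows "h = 0"
proof -
  have ev: "\<kappa> h w = 0" if w: "w \<in> hpart G 0" for w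
  proof -
    obtain Z where Z: "Z \<in> sl_part n 0" "w = \<pi> Z" using w psl_part[of 0] by blast
    define A where "A = distinct_diag n"
    define D where "D = mat (2 * (n + 1)) (2 * (n + 1)) (\<lambda>(i, j). if i = j then Z $$ (i, j) else 0)"
    define Q where "Q = mat (2 * (n + 1)) (2 * (n + 1))
      (\<lambda>(i, j). if i = j then 0 else Z $$ (i, j) / (A $$ (i, i) - A $$ (j, j)))"
    define O' where "O' = mat (2 * (n + 1)) (2 * (n + 1))
      (\<lambda>(i, j). (A $$ (i, i) - A $$ (j, j)) * Q $$ (i, j))"
    have A: "A \<in> sl_diag n" unfolding A_def by (rule distinct_diag_sl_diag)
    have Zsl: "Z \<in> sl_mat n" by (rule sl_part_sl[OF Z(1)])
    have D: "D \<in> sl_diag n"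
      using sl_mat_of_diagonal[OF _ Zsl, of "\<lambda>(i, j). if i = j then Z $$ (i, j) else 0"]
      unfolding sl_diag_def D_def by simp
    have Qsl: "Q \<in> sl_mat n" unfolding Q_def
      by (rule sl_mat_of_diagonal[OF _ zero_sl_mat]) simp
    have Q: "Q \<in> sl_part n 0"
      using Qsl Z(1) unfolding sl_part_def by (auto simp: Q_def)
    have O': "O' \<in> sl_mat n" unfolding O'_def
      by (rule sl_mat_of_diagonal[OF _ zero_sl_mat]) simp
    have "Z = D + O'"
    proof (rule eq_matI)
      fix i j assume "i < dim_row (D + O')" "j < dim_col (D + O')"
      then have ij: "i < 2 * (n + 1)" "j < 2 * (n + 1)" by (simp_all add: O'_def)
      then show "Z $$ (i, j) = (D + O') $$ (i, j)"
        using distinct_diag_entries[OF n ij] by (simp add: D_def O'_def Q_def A_def)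
    qed (use Zsl in \<open>simp_all add: O'_def\<close>)
    then have "w = \<pi> D + brack G (\<pi> A) (\<pi> Q)"
      using Z(2) psl_add[OF sl_diag_sl[OF D] O'] psl_diag_brack[OF A Q] unfolding O'_def by simp
    moreover have "\<kappa> h (\<pi> D) = 0" by (rule z[OF psl_cartanI[OF D]])
    moreover have "\<kappa> h (brack G (\<pi> A) (\<pi> Q)) = 0"
      using form_invariant[of h "\<pi> A" "\<pi> Q"] psl_cartan_commute[OF h psl_cartanI[OF A]] by simp
    ultimately show ?thesis by (simp add: form_add)
  qed
  have "\<kappa> h w = 0" for w
  proof -
    obtain y z' where yz: "y \<in> hpart G 0" "z' \<in> hpart G 1" "w = y + z'" by (rule part_decomp)
    have "\<kappa> h z' = 0" using form_parity[of 0 1] h psl_cartan_even yz(2) by auto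
    then show ?thesis using ev[OF yz(1)] unfolding yz(3) by (simp add: form_add)
  qed
  then show ?thesis using nondeg unfolding nondegenerate_form_def by blast
qed

lemma psl_diff_dual: 
  assumes "i < 2 * (n + 1)" "j < 2 * (n + 1)"
  shows "psl_diff n \<pi> i j \<in> dual_space (smul G) H"
proof -
  have "psl_diff n \<pi> i j (h + g) = psl_diff n \<pi> i j h + psl_diff n \<pi> i j g"
    if hg: "h \<in> H" "g \<in> H" for h g
  proof -
    obtain X Y where X: "X \<in> sl_diag n" "h = \<pi> X" and Y: "Y \<in> sl_diag n" "g = \<pi> Y"
      using hg by (meson psl_cartanE)
    have "h + g = \<pi> (X + Y)" using psl_add[OF sl_diag_sl sl_diag_sl] X Y by simp
    then show ?thesis
      using psl_diff_diag[OF sl_diag_add[OF X(1) Y(1)] assms] psl_diff_diag[OF X(1) assms]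
        psl_diff_diag[OF Y(1) assms] X Y sl_diag_sl[OF X(1)] sl_diag_sl[OF Y(1)] assms by simp
  qed
  moreover have "psl_diff n \<pi> i j (smul G a h) = a * psl_diff n \<pi> i j h" if h: "h \<in> H" for a h
  proof -
    obtain X where X: "X \<in> sl_diag n" "h = \<pi> X" using h by (rule psl_cartanE)
    have "smul G a h = \<pi> (a \<cdot>\<^sub>m X)" using psl_scale[OF sl_diag_sl[OF X(1)]] X by simp
    then show ?thesis
      using psl_diff_diag[OF sl_diag_smult[OF X(1)] assms] psl_diff_diag[OF X(1) assms]
        X sl_diag_sl[OF X(1)] assms by (simp add: right_diff_distrib)
  qed
  ultimately show ?thesis unfolding dual_space_def by (auto simp: psl_diff_def)
qed

lemma psl_diff_swap:
  assumes "i < 2 * (n + 1)" "j < 2 * (n + 1)"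
  shows "psl_diff n \<pi> j i = - psl_diff n \<pi> i j"
proof (rule ext)
  fix h show "psl_diff n \<pi> j i h = (- psl_diff n \<pi> i j) h"
  proof (cases "h \<in> H")
    case True
    then obtain X where "X \<in> sl_diag n" "h = \<pi> X" by (rule psl_cartanE)
    then show ?thesis using psl_diff_diag assms by simp
  qed (simp add: psl_diff_def)
qed

text \<open>If the pairing vanished, [x, y] would be orthogonal to \<open>H\<close>, hence zero, and
  its diagonal representative would be scalar. But 1 \<le> n leaves an index k besides i and j, with
  entry 0 at k against 1 at i.\<close>

lemma psl_root_pair:
  fixes i j :: nat
  defines "x \<equiv> \<pi> (unit_mat n i j)" and "y \<equiv> \<pi> (unit_mat n j i)"
  assumes ij: "i < 2 * (n + 1)" "j < 2 * (n + 1)" "i \<noteq> j"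
  shows "brack G x y \<in> H" "h \<in> H \<Longrightarrow> \<kappa> (brack G x y) h = \<kappa> x y * psl_diff n \<pi> i j h" "\<kappa> x y \<noteq> 0"
proof -
  have par: "index_parity n j i = index_parity n i j" unfolding index_parity_def by auto
  let ?s = "koszul (index_parity n i j) (index_parity n i j)"
  let ?D = "diag_of n (\<lambda>a. if a = i then 1 else if a = j then - ?s else 0)"
  have D: "?D \<in> sl_diag n" by (rule unit_bracket_sl_diag[OF ij])
  have xyD: "brack G x y = \<pi> ?D"
    unfolding x_def y_def
    using psl_brack[OF unit_mat_part[OF ij(3)] unit_mat_part[OF ij(3)[symmetric]]]
      unit_mat_bracket[OF ij] by (simp add: par)
  show xyH: "brack G x y \<in> H" unfolding xyD by (rule psl_cartanI[OF D])
  have form_xy: "\<kappa> (brack G x y) h = \<kappa> x y * psl_diff n \<pi> i j h" if h: "h \<in> H" for h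
  proof -
    have "brack G h y = smul G (- psl_diff n \<pi> i j h) y"
      unfolding y_def using psl_root_vector[OF h ij(2,1) ij(3)[symmetric]] psl_diff_swap[OF ij(1,2)] by simp
    then have "brack G y h = smul G (psl_diff n \<pi> i j h) y"
      using brack_even_skew[of h y] h psl_cartan_even by auto
    then show ?thesis using form_invariant[of x y h] by simp
  qed
  show "h \<in> H \<Longrightarrow> \<kappa> (brack G x y) h = \<kappa> x y * psl_diff n \<pi> i j h" by (rule form_xy)
  show "\<kappa> x y \<noteq> 0"
  proof
    assume "\<kappa> x y = 0"
    then have "\<pi> ?D = 0" using psl_cartan_form_nondeg[OF xyH] form_xy xyD by simp
    then obtain a where a: "?D = a \<cdot>\<^sub>m 1\<^sub>m (2 * (n + 1))" using psl_kernel[OF sl_diag_sl[OF D]] by blast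
    have "card {i, j} < card {..<2 * (n + 1)}" using n ij(3) by simp
    then obtain k where k: "k < 2 * (n + 1)" "k \<notin> {i, j}"
      by (metis card_mono finite.emptyI finite.insertI leD lessThan_iff subsetI)
    have "?D $$ (i, i) = ?D $$ (k, k)" unfolding a using ij k by simp
    then show False using ij k by (simp add: diag_of_def)
  qed
qed

end

section \<open>Affinization of psl(n+1, n+1)\<close>

context psl_superalgebra
begin

abbreviation "L2 \<equiv> affine2 G \<kappa> n \<pi>"

text \<open>The d1-degree e is stored beside \<alpha> because \<alpha> need not determine it: for n
  = 1 the differences \<epsilon>_1 - \<delta>_1 and \<delta>_2 - \<epsilon>_2 agree on
  \<open>H\<close>, and only \<sigma> tells them apart.\<close>

definition aff2 :: "('g \<Rightarrow> complex) \<Rightarrow> int \<Rightarrow> int \<Rightarrow> 'g affine2 \<Rightarrow> complex" where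
  "aff2 \<alpha> e k = affine2_ext H \<alpha> + of_int e * affine2_sigma H + of_int k * affine2_delta H"

lemma affine2_cartan_iff:
  "(f, a, b) \<in> affine2_cartan H \<longleftrightarrow> (\<exists>h\<in>H. f = Poly_Mapping.single 0 h)"
  unfolding affine2_cartan_def by auto

lemma cartan_L2 [simp]: "cartan L2 = affine2_cartan H"
  by (simp add: affine2_def Let_def)

lemma delta_L2 [simp]: "delta L2 = affine2_delta H"
  by (simp add: affine2_def Let_def)

lemma affine2_values [simp]:
  assumes "h \<in> H"
  shows "affine2_ext H \<alpha> (Poly_Mapping.single 0 h, a, b) = \<alpha> h"
    and "affine2_sigma H (Poly_Mapping.single 0 h, a, b) = 2 * fst b"
    and "affine2_delta H (Poly_Mapping.single 0 h, a, b) = snd b"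
  using assms unfolding affine2_ext_def affine2_sigma_def affine2_delta_def
  by (auto simp: affine2_cartan_iff)

lemma aff2_value [simp]:
  "h \<in> H \<Longrightarrow> aff2 \<alpha> e k (Poly_Mapping.single 0 h, a, (b1, b2)) = \<alpha> h + of_int e * (2 * b1) + of_int k * b2"
  by (simp add: aff2_def)

lemma aff2_add_delta: "aff2 \<alpha> e k + of_int l * affine2_delta H = aff2 \<alpha> e (k + l)"
  unfolding aff2_def by (rule ext) (simp add: algebra_simps)

lemma aff2_uminus: "- aff2 \<alpha> e k = aff2 (- \<alpha>) (- e) (- k)"
  unfolding aff2_def by (rule ext) (auto simp: affine2_ext_def)

lemma affine2_even: "cartan L2 \<subseteq> hpart L2 0"
  using psl_cartan_even gs.subspace_0[OF part_subspace]
  unfolding affine2_def Let_def affine2_cartan_def loop_part_def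
  by (auto simp: lookup_single when_def)

lemma affine2_dual:
  assumes "\<alpha> \<in> dual_space (smul G) H"
  shows "aff2 \<alpha> e k \<in> cartan_dual L2" and "affine2_delta H \<in> cartan_dual L2"
proof -
  have sub: "h + g \<in> H" "smul G z h \<in> H" if "h \<in> H" "g \<in> H" for h g z
    using that psl_cartan_subspace gs.subspace_add gs.subspace_scale by blast+
  have \<alpha>: "\<alpha> (h + g) = \<alpha> h + \<alpha> g" "\<alpha> (smul G z h) = z * \<alpha> h" if "h \<in> H" "g \<in> H" for h g z
    using that assms unfolding dual_space_def by blast+
  have out: "affine2_ext H \<alpha> x = 0" "affine2_sigma H x = 0" "affine2_delta H x = 0"
    if "x \<notin> affine2_cartan H" for x
    using that unfolding affine2_ext_def affine2_sigma_def affine2_delta_def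
    by (auto split: prod.splits)
  have out': "aff2 \<alpha> e k x = 0" if "x \<notin> affine2_cartan H" for x
    using out[OF that] by (simp add: aff2_def)
  show "aff2 \<alpha> e k \<in> cartan_dual L2" "affine2_delta H \<in> cartan_dual L2"
    unfolding cartan_dual_def dual_space_def cartan_L2
    using sub \<alpha> out out'
    by (auto simp: affine2_def Let_def affine2_cartan_def algebra_simps simp flip: single_add)
qed

lemma loop_dstar_single:
  "loop_dstar n \<pi> (Poly_Mapping.single k x) = Poly_Mapping.single k (psl_dstar n \<pi> x)"
proof -
  have "psl_dstar n \<pi> 0 = 0" by (rule psl_dstar_even) (rule gs.subspace_0[OF part_subspace])
  then show ?thesis unfolding loop_dstar_def
    by (intro poly_mapping_eqI) (simp add: Poly_Mapping.map.rep_eq lookup_single when_def)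
qed

lemma dstar_cocycle_single:
  "dstar_cocycle n \<pi> \<kappa> (Poly_Mapping.single p x) (Poly_Mapping.single q y) =
    (if p + q = 0 then \<kappa> (psl_dstar n \<pi> x) y / of_nat (n + 1) else 0)"
proof -
  have "psl_dstar n \<pi> 0 = 0" by (rule psl_dstar_even) (rule gs.subspace_0[OF part_subspace])
  moreover have "q = - p \<longleftrightarrow> p + q = 0" by arith
  ultimately show ?thesis
    unfolding dstar_cocycle_def by (simp add: lookup_single when_def)
qed

text \<open>\<open>psl_dstar\<close> kills the even g, and g has loop degree 0, so neither cocycle
  contributes; d1 and d2 yield the summands e\<sigma> and k\<delta>.\<close>

lemma affine2_root_vector:
  assumes x: "\<And>h. h \<in> H \<Longrightarrow> brack G h x = smul G (\<alpha> h) x" "psl_dstar n \<pi> x = smul G (of_int e) x"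
  shows "(Poly_Mapping.single k x, (0, 0), (0, 0)) \<in> root_space L2 (cartan L2) (aff2 \<alpha> e k)"
proof -
  have "brack L2 h (Poly_Mapping.single k x, (0, 0), (0, 0)) =
      smul L2 (aff2 \<alpha> e k h) (Poly_Mapping.single k x, (0, 0), (0, 0))"
    if hc: "h \<in> cartan L2" for h
  proof -
    obtain g a1 a2 b1 b2 where h: "h = (Poly_Mapping.single 0 g, (a1, a2), (b1, b2))" "g \<in> H"
      using hc unfolding cartan_L2 affine2_cartan_def by auto
    have "psl_dstar n \<pi> g = 0" using h(2) psl_cartan_even psl_dstar_even by blast
    then show ?thesis
      unfolding h(1) using h(2) x
      by (simp add: affine2_def Let_def loop_dstar_single dstar_cocycle_single
          gs.scale_left_distrib mult_ac flip: single_add)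
  qed
  then show ?thesis unfolding root_space_def by blast
qed

lemma affine2_dual_form:
  assumes T: "T \<in> H" "\<And>h. h \<in> H \<Longrightarrow> \<kappa> T h = \<alpha> h"
  shows "dual_form L2 (aff2 \<alpha> e k) (aff2 \<alpha> e k) = \<alpha> T"
proof -
  \<comment> \<open>\<sigma>(d1) = 2 and (c1, d1) = 1, hence the coefficient 2e of c1.\<close>
  let ?t = "(Poly_Mapping.single 0 T, (2 * of_int e, of_int k), (0, 0))"
  have "dual_form L2 (aff2 \<alpha> e k) (aff2 \<alpha> e k) = aff2 \<alpha> e k ?t"
  proof (rule dual_form_eq)
    show "?t \<in> cartan L2" using T(1) by (auto simp: affine2_cartan_iff)
    show "cform L2 ?t h = aff2 \<alpha> e k h" if "h \<in> cartan L2" for h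
      using that T unfolding cartan_L2 affine2_cartan_def by (auto simp: affine2_def Let_def)
  next
    fix u assume u: "u \<in> cartan L2" and eq: "\<And>h. h \<in> cartan L2 \<Longrightarrow> cform L2 u h = aff2 \<alpha> e k h"
    obtain h a1 a2 b1 b2 where u': "u = (Poly_Mapping.single 0 h, (a1, a2), (b1, b2))" "h \<in> H"
      using u unfolding cartan_L2 affine2_cartan_def by auto
    have 0: "0 \<in> H" using psl_cartan_subspace gs.subspace_0 by blast
    have eq': "\<kappa> h g + a1 * d1 + b1 * c1 + a2 * d2 + b2 * c2 = \<alpha> g + of_int e * (2 * d1) + of_int k * d2"
      if "g \<in> H" for g c1 c2 d1 d2
      using eq[of "(Poly_Mapping.single 0 g, (c1, c2), (d1, d2))"] that u'
      unfolding cartan_L2 by (auto simp: affine2_cartan_iff affine2_def Let_def)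
    have \<alpha>0: "\<alpha> 0 = 0" using T(2)[OF 0] by simp
    have "a1 = 2 * of_int e" using eq'[OF 0, of 1 0 0 0] \<alpha>0 by simp
    moreover have "a2 = of_int k" using eq'[OF 0, of 0 0 1 0] \<alpha>0 by simp
    moreover have "b1 = 0" using eq'[OF 0, of 0 1 0 0] \<alpha>0 by simp
    moreover have "b2 = 0" using eq'[OF 0, of 0 0 0 1] \<alpha>0 by simp
    moreover have "h - T = 0"
    proof (rule psl_cartan_form_nondeg)
      show "h - T \<in> H" using u'(2) T(1) psl_cartan_subspace gs.subspace_diff by blast
      show "\<kappa> (h - T) g = 0" if "g \<in> H" for g
        using eq'[OF that, of 0 0 0 0] T(2)[OF that] by (simp add: form_diff)
    qed
    ultimately show "u = ?t" unfolding u' by simp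
  qed
  then show ?thesis using T(1) by simp
qed

text \<open>Ordered pairs of indices absorb the four families: the block position of (i, j) fixes
  the coefficient of \<sigma>, and negated odd roots are the pairs in reversed order. Each root then
  comes with its matrix unit.\<close>

lemma affine2_roots:
  "roots L2 = {aff2 (psl_diff n \<pi> i j) (index_degree n i j) k | i j k.
     i < 2 * (n + 1) \<and> j < 2 * (n + 1)}" (is "_ = ?R")
proof -
  let ?K = "2 * (n + 1)"
  let ?D = "\<lambda>i j. affine2_ext H (psl_diff n \<pi> i j)"
  have neg: "- (?D i j + affine2_sigma H) = ?D j i - affine2_sigma H" if "i < ?K" "j < ?K" for i j
    unfolding psl_diff_swap[OF that] by (rule ext) (auto simp: affine2_ext_def)
  have base: "affine2_base_roots n \<pi> =
    {?D i j + of_int (index_degree n i j) * affine2_sigma H | i j. i < ?K \<and> j < ?K}" (is "_ = ?B")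
  proof (intro equalityI subsetI)
    fix r assume "r \<in> affine2_base_roots n \<pi>"
    then consider (e) i j where "i < n + 1" "j < n + 1" "r = ?D i j"
      | (d) i j where "n + 1 \<le> i" "i < ?K" "n + 1 \<le> j" "j < ?K" "r = ?D i j"
      | (p) i j where "i < n + 1" "n + 1 \<le> j" "j < ?K" "r = ?D i j + affine2_sigma H"
      | (m) i j where "i < n + 1" "n + 1 \<le> j" "j < ?K" "r = - (?D i j + affine2_sigma H)"
      unfolding affine2_base_roots_def Let_def by (auto simp del: One_nat_def add_Suc_right)
    then have "\<exists>i j. i < ?K \<and> j < ?K \<and> r = ?D i j + of_int (index_degree n i j) * affine2_sigma H"
    proof cases
      case e
      then show ?thesis by (intro exI[of _ i] exI[of _ j]) (simp add: index_degree_def)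
    next
      case d
      then show ?thesis by (intro exI[of _ i] exI[of _ j]) (simp add: index_degree_def)
    next
      case p
      then show ?thesis by (intro exI[of _ i] exI[of _ j]) (simp add: index_degree_def)
    next
      case m
      then show ?thesis using neg[of i j]
        by (intro exI[of _ j] exI[of _ i]) (simp add: index_degree_def)
    qed
    then show "r \<in> ?B" by blast
  next
    fix r assume "r \<in> ?B"
    then obtain i j where ij: "i < ?K" "j < ?K"
      and r: "r = ?D i j + of_int (index_degree n i j) * affine2_sigma H" by blast
    consider "i < n + 1" "j < n + 1" | "n + 1 \<le> i" "n + 1 \<le> j" | "i < n + 1" "n + 1 \<le> j"
      | "n + 1 \<le> i" "j < n + 1" by linarith
    then show "r \<in> affine2_base_roots n \<pi>"
    proof cases
      case 1
      then have "r = ?D i j" using r by (simp add: index_degree_def)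
      moreover have "i \<in> {0..<n + 1}" "j \<in> {0..<n + 1}" using 1 ij by simp_all
      ultimately show ?thesis unfolding affine2_base_roots_def Let_def by blast
    next
      case 2
      then have "r = ?D i j" using r by (simp add: index_degree_def)
      moreover have "i \<in> {n + 1..<2 * (n + 1)}" "j \<in> {n + 1..<2 * (n + 1)}" using 2 ij by simp_all
      ultimately show ?thesis unfolding affine2_base_roots_def Let_def by blast
    next
      case 3
      then have "r = ?D i j + affine2_sigma H" using r by (simp add: index_degree_def)
      moreover have "i \<in> {0..<n + 1}" "j \<in> {n + 1..<2 * (n + 1)}" using 3 ij by simp_all
      ultimately show ?thesis unfolding affine2_base_roots_def Let_def by blast
    next
      case 4
      then have "r = - (?D j i + affine2_sigma H)"
        using r neg[OF ij(2,1)] by (simp add: index_degree_def)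
      moreover have "i \<in> {n + 1..<2 * (n + 1)}" "j \<in> {0..<n + 1}" using 4 ij by simp_all
      ultimately show ?thesis unfolding affine2_base_roots_def Let_def by blast
    qed
  qed
  have "roots L2 = {\<alpha> + of_int k * affine2_delta H | \<alpha> k. \<alpha> \<in> affine2_base_roots n \<pi>}"
    by (simp add: affine2_def Let_def)
  then show ?thesis unfolding base aff2_def by blast
qed

lemma affine2_alternatives:
  assumes sh: "has_shadow L2 M" and \<beta>: "\<beta> \<in> real_roots L2"
  shows "string_alternatives L2 M \<beta>"
proof -
  obtain i j m where ij: "i < 2 * (n + 1)" "j < 2 * (n + 1)"
    and b: "\<beta> = aff2 (psl_diff n \<pi> i j) (index_degree n i j) m"
    using \<beta> unfolding real_roots_def affine2_roots by blast
  define \<alpha> where "\<alpha> = psl_diff n \<pi> i j"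
  define e where "e = index_degree n i j"
  have b: "\<beta> = aff2 \<alpha> e m" using b unfolding \<alpha>_def e_def .
  have m\<alpha>: "- \<alpha> = psl_diff n \<pi> j i" "- e = index_degree n j i"
    unfolding \<alpha>_def e_def psl_diff_swap[OF ij] by (simp_all add: index_degree_def)
  have ad: "\<alpha> \<in> dual_space (smul G) H" unfolding \<alpha>_def by (rule psl_diff_dual[OF ij])
  have neq: "i \<noteq> j"
  proof
    assume "i = j"
    \<comment> \<open>Exchanging equal indices gives \<alpha> = -\<alpha>. Such a root is isotropic
      and cannot be real.\<close>
    then have "\<alpha> h = 0" for h
      using psl_diff_swap[OF ij] fun_cong[of "psl_diff n \<pi> j i" "- psl_diff n \<pi> i j" h]
      unfolding \<alpha>_def by simp
    then have "dual_form L2 (aff2 \<alpha> e m) (aff2 \<alpha> e m) = 0"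
      using affine2_dual_form[of 0 \<alpha> e m] psl_cartan_subspace gs.subspace_0 by simp
    then show False using \<beta> unfolding real_roots_def b by simp
  qed
  define x where "x = \<pi> (unit_mat n i j)"
  define y where "y = \<pi> (unit_mat n j i)"
  define p where "p = index_parity n i j"
  have xp: "x \<in> hpart G p" "y \<in> hpart G p"
    using imageI[OF unit_mat_part[OF neq, of n], of \<pi>]
      imageI[OF unit_mat_part[OF neq[symmetric], of n], of \<pi>]
    unfolding x_def y_def p_def psl_part by (simp_all add: index_parity_def eq_commute)
  have T: "brack G x y \<in> H" "\<And>h. h \<in> H \<Longrightarrow> \<kappa> (brack G x y) h = \<kappa> x y * \<alpha> h" "\<kappa> x y \<noteq> 0"
    unfolding x_def y_def \<alpha>_def by (rule psl_root_pair[OF ij neq], assumption?)+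
  have xr: "brack G h x = smul G (\<alpha> h) x" "brack G h y = smul G ((- \<alpha>) h) y" if "h \<in> H" for h
    using psl_root_vector[OF that ij neq] psl_root_vector[OF that ij(2,1) neq[symmetric]]
    unfolding m\<alpha> unfolding x_def y_def \<alpha>_def by blast+
  have xd: "psl_dstar n \<pi> x = smul G (of_int e) x" "psl_dstar n \<pi> y = smul G (of_int (- e)) y"
    using psl_dstar_unit[OF neq] psl_dstar_unit[OF neq[symmetric]]
    unfolding m\<alpha> unfolding x_def y_def e_def by blast+
  let ?T = "brack G x y" and ?c = "\<kappa> x y"
  have sub: "smul G z ?T \<in> H" for z using T(1) psl_cartan_subspace gs.subspace_scale by blast
  have \<alpha>_scale: "\<alpha> (smul G z ?T) = z * \<alpha> ?T" for z
    using ad T(1) unfolding dual_space_def by blast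
  have df: "dual_form L2 (aff2 \<alpha> e k) (aff2 \<alpha> e k) = \<alpha> ?T / ?c" for k
    using affine2_dual_form[OF sub[of "1 / ?c"], of \<alpha> e k] T(2,3) \<alpha>_scale by simp
  have dfm: "dual_form L2 (aff2 (- \<alpha>) (- e) k) (aff2 (- \<alpha>) (- e) k) = \<alpha> ?T / ?c" for k
    using affine2_dual_form[OF sub[of "- 1 / ?c"], of "- \<alpha>" "- e" k] T(2,3) \<alpha>_scale[of "- 1 / ?c"]
    by simp
  have nz: "\<alpha> ?T \<noteq> 0" using \<beta> df[of m] unfolding real_roots_def b by auto
  have roots: "aff2 \<alpha> e k \<in> roots L2" "aff2 (- \<alpha>) (- e) k \<in> roots L2" for k
    using ij unfolding m\<alpha> affine2_roots unfolding \<alpha>_def e_def by blast+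
  show ?thesis
  proof (rule string_alternatives_of_triples[OF sh affine2_even])
    show "\<beta> \<in> cartan_dual L2" unfolding b by (rule affine2_dual(1)[OF ad])
    show "delta L2 \<in> cartan_dual L2" unfolding delta_L2 by (rule affine2_dual(2)[OF ad])
    show "\<beta> + of_int k * delta L2 \<in> real_roots L2" for k
      unfolding delta_L2 b aff2_add_delta real_roots_def using roots(1) df nz T(3) by simp
    show "- \<beta> + of_int k * delta L2 \<in> real_roots L2" for k
      unfolding delta_L2 b aff2_uminus aff2_add_delta real_roots_def
      using roots(2) dfm nz T(3) by simp
    show "\<exists>p x y. root_triple L2 p (\<beta> + of_int k * delta L2) x y" for k
    proof -
      let ?x = "(Poly_Mapping.single (m + k) x, (0, 0), (0, 0)) :: 'g affine2"
      let ?y = "(Poly_Mapping.single (- (m + k)) y, (0, 0), (0, 0)) :: 'g affine2"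
      \<comment> \<open>The cocycle of \<open>psl_dstar\<close> adds a multiple of c1 and the loop
        cocycle one of c2. Both are invisible to the roots, since \<sigma> and \<delta> live on d1
        and d2.\<close>
      have xyT: "brack L2 ?x ?y =
        (Poly_Mapping.single 0 ?T, (of_int e * ?c / of_nat (n + 1), of_int (m + k) * ?c), (0, 0))"
        by (simp add: affine2_def Let_def loop_dstar_single dstar_cocycle_single xd)
      have yx: "brack G y x = smul G (- koszul p p) ?T"
        using brack_skew[OF xp(2,1)] by simp
      have "\<kappa> y x = koszul p p * ?c" using form_sym[OF xp(2,1)] .
      then have yxT: "brack L2 ?y ?x = smul L2 (- koszul p p) (brack L2 ?x ?y)"
        unfolding xyT
        by (simp add: affine2_def Let_def loop_dstar_single dstar_cocycle_single xd yx algebra_simps)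
      have par: "?x \<in> hpart L2 p" "?y \<in> hpart L2 p"
        using xp gs.subspace_0[OF part_subspace]
        by (auto simp: affine2_def Let_def loop_part_def lookup_single when_def)
      have shift: "\<beta> + of_int k * delta L2 = aff2 \<alpha> e (m + k)"
        unfolding delta_L2 b aff2_add_delta ..
      have "root_triple L2 p (\<beta> + of_int k * delta L2) ?x ?y"
        unfolding root_triple_def
      proof (intro conjI)
        show "?x \<in> root_space L2 (cartan L2) (\<beta> + of_int k * delta L2)"
          unfolding shift using xr(1) xd(1) by (rule affine2_root_vector)
        show "?y \<in> root_space L2 (cartan L2) (- (\<beta> + of_int k * delta L2))"
          unfolding shift aff2_uminus using xr(2) xd(2) by (rule affine2_root_vector)
        show "brack L2 ?x ?y \<in> cartan L2"
          unfolding xyT using T(1) by (auto simp: affine2_cartan_iff)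
        have "smul L2 (- koszul p p) (brack L2 ?x ?y) =
          (Poly_Mapping.single 0 (smul G (- koszul p p) ?T),
            (- koszul p p * (of_int e * ?c / of_nat (n + 1)), - koszul p p * (of_int (m + k) * ?c)), (0, 0))"
          unfolding xyT by (simp add: affine2_def Let_def)
        then show "brack L2 ?y ?x \<in> cartan L2"
          unfolding yxT cartan_L2 using sub affine2_cartan_iff by metis
        show "delta L2 (brack L2 ?x ?y) = 0" unfolding delta_L2 xyT using T(1) by simp
        show "(\<beta> + of_int k * delta L2) (brack L2 ?x ?y) \<noteq> 0"
          unfolding shift xyT using T(1) nz by simp
      qed (use par yxT in blast)+
      then show ?thesis by blast
    qed
  qed
qed

end

lemma basic_classical_quadratic:
  assumes "basic_classical G \<kappa>" shows "quadratic_superalgebra G \<kappa>"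
  using assms unfolding basic_classical_def simple_superalgebra_def by unfold_locales blast+

theorem theorem3p9:
  fixes G :: "'g::ab_group_add lie_data"
    and \<kappa> :: "'g \<Rightarrow> 'g \<Rightarrow> complex"
  assumes "basic_classical G \<kappa>"
  shows "(\<not> type_Ann G \<longrightarrow>
           (\<forall>h0 (M :: ('g affine1, 'm::ab_group_add) module_data) \<beta>.
              cartan_subalgebra G h0 \<and> has_shadow (affine1 G \<kappa> h0) M
                \<and> \<beta> \<in> real_roots (affine1 G \<kappa> h0)
              \<longrightarrow> string_alternatives (affine1 G \<kappa> h0) M \<beta>)) \<and>
         (\<forall>n \<pi> (M :: ('g affine2, 'm) module_data) \<beta>.
              1 \<le> n \<and> psl_projection n G \<pi> \<and> has_shadow (affine2 G \<kappa> n \<pi>) M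
                \<and> \<beta> \<in> real_roots (affine2 G \<kappa> n \<pi>)
              \<longrightarrow> string_alternatives (affine2 G \<kappa> n \<pi>) M \<beta>)"
proof -
  interpret quadratic_superalgebra G \<kappa> by (rule basic_classical_quadratic[OF assms])
  show ?thesis
  proof (intro conjI impI allI; elim conjE)
    fix h0 and M :: "('g affine1, 'm) module_data" and \<beta>
    assume "cartan_subalgebra G h0" "has_shadow (affine1 G \<kappa> h0) M"
      "\<beta> \<in> real_roots (affine1 G \<kappa> h0)"
    then show "string_alternatives (affine1 G \<kappa> h0) M \<beta>" by (rule affine1_alternatives)
  next
    fix n \<pi> and M :: "('g affine2, 'm) module_data" and \<beta>
    assume n: "1 \<le> n" "psl_projection n G \<pi>"
      and sh: "has_shadow (affine2 G \<kappa> n \<pi>) M" "\<beta> \<in> real_roots (affine2 G \<kappa> n \<pi>)"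
    interpret psl_superalgebra G \<kappa> n \<pi> using n by unfold_locales
    show "string_alternatives (affine2 G \<kappa> n \<pi>) M \<beta>" using sh by (rule affine2_alternatives)
  qed
qed

end
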